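(* Let $G$ be a critical graph with $m$ edges. Then for all integers $t \geq 100\,m^3$, the graph $G \vee K_t$ is robustly critical.
   Context: All graphs are finite and simple. For an integer $k \geq 1$, a graph $G$ is $k$-critical if $\chi(G) = k$ and $\chi(G') < k$ for every proper subgraph $G'$ of $G$; $G$ is critical if it is $k$-critical for some $k \geq 1$. The join $G \vee H$ of graphs $G$ and $H$ is obtained from vertex-disjoint copies of $G$ and $H$ by making every vertex of $G$ adjacent to every vertex of $H$. $K_t$ is the complete graph on $t$ vertices. A cover of a graph $G$ is a pair $\mathcal{H} = (L,H)$, where $H$ is a graph and $L$ is a function assigning to each $v \in V(G)$ a subset $L(v) \subseteq V(H)$ such that: the sets $L(v)$, $v \in V(G)$, are pairwise disjoint, independent in $H$, and have union $V(H)$; and whenever (for distinct $u,v\in V(G)$) the set $E_H(L(u),L(v))$ of edges of $H$ between $L(u)$ and $L(v)$ is nonempty, then $uv \in E(G)$ and $E_H(L(u),L(v))$ is a matching (not necessarily perfect). A proper $\mathcal{H}$-coloring of $G$ is an independent set $T$ of $H$ containing exactly one vertex from each $L(v)$; $G$ is $\mathcal{H}$-colorable if one exists, and otherwise $\mathcal{H}$ is a bad cover of $G$. A cover is $q$-fold if $|L(v)| = q$ for all $v \in V(G)$ (with $q = 0$ allowed). A $q$-fold cover $\mathcal{H} = (L,H)$ of $G$ is canonical if there is a mapping $\lambda \colon V(H) \to [q]$, where $[q]=\{1,\ldots,q\}$, such that for each $v \in V(G)$ the restriction $\lambda|_{L(v)}$ is a bijection from $L(v)$ to $[q]$, and for all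 $uv \in E(G)$, $c \in L(u)$, $c' \in L(v)$, we have $cc' \in E(H)$ if and only if $\lambda(c) = \lambda(c')$. (In particular the $0$-fold cover is canonical.) For $k \geq 1$, a graph $G$ is robustly $k$-critical if it is $k$-critical and every bad $(k-1)$-fold cover of $G$ is canonical. $G$ is robustly critical if it is robustly $k$-critical for some $k \geq 1$. *)

theory Defs
  imports "HOL-Library.Ramsey" "HOL-Library.Disjoint_Sets"
begin

record 'a graph =
  verts :: "'a set"
  edges :: "'a set set"

definition simple_graph :: "'a graph \<Rightarrow> bool" where
  "simple_graph G \<longleftrightarrow> finite (verts G) \<and> edges G \<subseteq> [verts G]\<^bsup>2\<^esup>"

definition proper_subgraph :: "'a graph \<Rightarrow> 'a graph \<Rightarrow> bool" where
  "proper_subgraph G' G \<longleftrightarrow>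
     simple_graph G' \<and> verts G' \<subseteq> verts G \<and> edges G' \<subseteq> edges G \<and> G' \<noteq> G"

definition proper_coloring :: "'a graph \<Rightarrow> nat \<Rightarrow> ('a \<Rightarrow> nat) \<Rightarrow> bool" where
  "proper_coloring G k f \<longleftrightarrow>
     f \<in> verts G \<rightarrow> {1..k} \<and> (\<forall>u v. {u, v} \<in> edges G \<longrightarrow> f u \<noteq> f v)"

definition chromatic_number :: "'a graph \<Rightarrow> nat" where
  "chromatic_number G = (LEAST k. \<exists>f. proper_coloring G k f)"

definition k_critical :: "nat \<Rightarrow> 'a graph \<Rightarrow> bool" where
  "k_critical k G \<longleftrightarrow>
     simple_graph G \<and> chromatic_number G = k \<and>
     (\<forall>G'. proper_subgraph G' G \<longrightarrow> chromatic_number G' < k)"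

definition critical :: "'a graph \<Rightarrow> bool" where
  "critical G \<longleftrightarrow> (\<exists>k\<ge>1. k_critical k G)"

definition graph_join :: "'a graph \<Rightarrow> 'b graph \<Rightarrow> ('a + 'b) graph" where
  "graph_join G H =
     \<lparr>verts = verts G <+> verts H,
      edges = (`) Inl ` edges G \<union> (`) Inr ` edges H \<union>
              {{Inl u, Inr v} | u v. u \<in> verts G \<and> v \<in> verts H}\<rparr>"

definition complete_graph :: "nat \<Rightarrow> nat graph" where
  "complete_graph t = \<lparr>verts = {1..t}, edges = [{1..t}]\<^bsup>2\<^esup>\<rparr>"

lemma simple_graph_complete_graph: "simple_graph (complete_graph t)"
  by (simp add: simple_graph_def complete_graph_def)

lemma simple_graph_graph_join:
  assumes "simple_graph G" "simple_graph H"
  shows "simple_graph (graph_join G H)"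
proof -
  have "(`) Inl ` edges G \<subseteq> [verts G <+> verts H]\<^bsup>2\<^esup>"
    using assms(1) by (fastforce simp: simple_graph_def elim!: nsets2_E)
  moreover have "(`) Inr ` edges H \<subseteq> [verts G <+> verts H]\<^bsup>2\<^esup>"
    using assms(2) by (fastforce simp: simple_graph_def elim!: nsets2_E)
  ultimately show ?thesis
    using assms by (auto simp: simple_graph_def graph_join_def)
qed

definition edges_between :: "'a graph \<Rightarrow> 'a set \<Rightarrow> 'a set \<Rightarrow> 'a set set" where
  "edges_between H A B = {e \<in> edges H. \<exists>a\<in>A. \<exists>b\<in>B. e = {a, b}}"

definition cover :: "'a graph \<Rightarrow> ('a \<Rightarrow> 'c set) \<Rightarrow> 'c graph \<Rightarrow> bool" where
  "cover G L H \<longleftrightarrow>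
     simple_graph H \<and>
     disjoint_family_on L (verts G) \<and>
     (\<forall>v\<in>verts G. indep (L v) (edges H)) \<and>
     (\<Union>v\<in>verts G. L v) = verts H \<and>
     (\<forall>u\<in>verts G. \<forall>v\<in>verts G. u \<noteq> v \<and> edges_between H (L u) (L v) \<noteq> {} \<longrightarrow>
        {u, v} \<in> edges G \<and> disjoint (edges_between H (L u) (L v)))"

definition fold_cover :: "nat \<Rightarrow> 'a graph \<Rightarrow> ('a \<Rightarrow> 'c set) \<Rightarrow> 'c graph \<Rightarrow> bool" where
  "fold_cover q G L H \<longleftrightarrow> cover G L H \<and> (\<forall>v\<in>verts G. card (L v) = q)"

definition cover_coloring :: "'a graph \<Rightarrow> ('a \<Rightarrow> 'c set) \<Rightarrow> 'c graph \<Rightarrow> 'c set \<Rightarrow> bool" where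
  "cover_coloring G L H T \<longleftrightarrow>
     T \<subseteq> verts H \<and> indep T (edges H) \<and> (\<forall>v\<in>verts G. \<exists>!x. x \<in> T \<inter> L v)"

definition bad_cover :: "'a graph \<Rightarrow> ('a \<Rightarrow> 'c set) \<Rightarrow> 'c graph \<Rightarrow> bool" where
  "bad_cover G L H \<longleftrightarrow> cover G L H \<and> \<not> (\<exists>T. cover_coloring G L H T)"

definition canonical_cover :: "nat \<Rightarrow> 'a graph \<Rightarrow> ('a \<Rightarrow> 'c set) \<Rightarrow> 'c graph \<Rightarrow> bool" where
  "canonical_cover q G L H \<longleftrightarrow>
     fold_cover q G L H \<and>
     (\<exists>lam. lam \<in> verts H \<rightarrow> {1..q} \<and>
        (\<forall>v\<in>verts G. bij_betw lam (L v) {1..q}) \<and>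
        (\<forall>u v. {u, v} \<in> edges G \<longrightarrow>
           (\<forall>c\<in>L u. \<forall>c'\<in>L v. {c, c'} \<in> edges H \<longleftrightarrow> lam c = lam c')))"

(* The cover graphs range over all graphs with vertices in the type 'c, passed explicitly
   because HOL cannot quantify over types inside a definition.  With 'c left free in a
   theorem, the statement covers cover graphs on every vertex type. *)
definition robustly_k_critical :: "'c itself \<Rightarrow> nat \<Rightarrow> 'a graph \<Rightarrow> bool" where
  "robustly_k_critical (_ :: 'c itself) k G \<longleftrightarrow>
     k_critical k G \<and>
     (\<forall>(L :: 'a \<Rightarrow> 'c set) H.
        fold_cover (k - 1) G L H \<and> bad_cover G L H \<longrightarrow> canonical_cover (k - 1) G L H)"

definition robustly_critical :: "'c itself \<Rightarrow> 'a graph \<Rightarrow> bool" where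
  "robustly_critical C G \<longleftrightarrow> (\<exists>k\<ge>1. robustly_k_critical C k G)"

end

theory Submission
  imports Defs
begin

text \<open>
  Let V be the vertex set of the critical graph, A that of the added clique, and consider a bad
  cover of the join.  When vertices of A are coloured, a vertex v of V gains whenever a chosen
  colour has no neighbour in the list of v, or two chosen colours share a neighbour there; once
  the gain reaches the degree, v can safely be coloured last.  A partial colouring of few
  vertices of A with maximal truncated total gain therefore leaves most colours free of
  further gains, and this makes the cover canonical on many colours ("labels"), first for V and
  a few vertices of A.  If some vertex of V had been saturated, the unsaturated ones could be
  coloured with k - 1 labels, and greedy colouring of A and of the saturated vertices would
  finish.  Otherwise V can be coloured with k generic labels, and a single further gain would
  allow a greedy completion, so the labels extend canonically to the whole join.

  The cover now splits into a canonical part with at least k labels and a rest R with fewer than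
  t colours per vertex.  Badness says that a partial colouring from R never reduces the
  chromatic number of what remains below the number of labels plus one.  On A together with one
  vertex of V this means that any r vertices coloured from R block all of R on every other
  vertex, where r is the size of the lists of R, so R is canonical there; criticality with
  respect to edges then forces it to be canonical on the edges inside V.
\<close>

section \<open>Partial colourings of covers\<close>

text \<open>Lists have \<open>k - 1 + t\<close> colours. If V is coloured with k labels and then A
  vertex by vertex, the last vertex of A can lose \<open>k + (t - 1)\<close> colours, exactly its
  whole list. So everything turns on saving one colour, and every deviation from the canonical
  pattern is turned into such a saving. It must be visible at the vertex coloured last, so a set As
  of \<open>card V\<close> vertices of A is held back: outside As a vertex may lose a colour to each
  vertex of V instead of to each label, and the reserve pays for that. Labels are first sought on As
  only, because the number of labels spoilt by the coloured set B is bounded by the product of the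
  sizes of As, V and B, which must not grow with t. All sizes are measured in m:
  \<open>card V\<close> and k are at most \<open>2 * m\<close>, the truncated gain is at most the
  degree sum \<open>2 * m\<close>, hence B has at most \<open>4 * m\<close> vertices. At most
  \<open>16 * m ^ 3\<close> labels are spoilt, and more than \<open>12 * m ^ 2\<close> have to
  survive so that a label free of conflicts can always be found; this is what the cubic bound on t
  provides. For an edgeless critical graph, which is a single vertex, the join is a clique and is
  treated directly.\<close>

locale list_cover =
  fixes P :: "'v set" and adj :: "'v \<Rightarrow> 'v \<Rightarrow> bool"
    and L :: "'v \<Rightarrow> 'c set" and sim :: "'c \<Rightarrow> 'c \<Rightarrow> bool" (infix \<open>\<sim>\<close> 50)
  assumes finite_P: "finite P"
    and finite_L: "v \<in> P \<Longrightarrow> finite (L v)"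
    and adj_sym: "adj u v \<Longrightarrow> adj v u"
    and adj_irrefl: "\<not> adj v v"
    and L_disjoint: "\<lbrakk>u \<in> P; v \<in> P; c \<in> L u; c \<in> L v\<rbrakk> \<Longrightarrow> u = v"
    and sim_sym: "c \<sim> d \<Longrightarrow> d \<sim> c"
    and sim_adj: "\<lbrakk>u \<in> P; v \<in> P; c \<in> L u; d \<in> L v; c \<sim> d\<rbrakk> \<Longrightarrow> adj u v"
    and sim_unique: "\<lbrakk>u \<in> P; v \<in> P; c \<in> L u; d \<in> L v; d' \<in> L v; c \<sim> d; c \<sim> d'\<rbrakk> \<Longrightarrow> d = d'"
begin

definition colors :: "'v set \<Rightarrow> ('v \<Rightarrow> 'c) \<Rightarrow> bool" where
  "colors D \<phi> \<longleftrightarrow> (\<forall>v\<in>D. \<phi> v \<in> L v) \<and> (\<forall>u\<in>D. \<forall>v\<in>D. \<not> \<phi> u \<sim> \<phi> v)"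

definition hit :: "'v set \<Rightarrow> ('v \<Rightarrow> 'c) \<Rightarrow> 'v \<Rightarrow> 'c set" where
  "hit D \<phi> z = {c \<in> L z. \<exists>d\<in>D. \<phi> d \<sim> c}"

section \<open>Counting blocked colours\<close>

lemma finite_sub_P: "D \<subseteq> P \<Longrightarrow> finite D"
  using finite_P finite_subset by blast

lemma hit_subset: "hit D \<phi> z \<subseteq> L z"
  by (auto simp: hit_def)

lemma finite_hit: "z \<in> P \<Longrightarrow> finite (hit D \<phi> z)"
  using finite_L hit_subset finite_subset by metis

lemma hit_Un: "hit (D \<union> E) \<phi> z = hit D \<phi> z \<union> hit E \<phi> z"
  by (auto simp: hit_def)

lemma hit_cong: "(\<And>d. d \<in> D \<Longrightarrow> \<phi> d = \<psi> d) \<Longrightarrow> hit D \<phi> z = hit D \<psi> z"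
  by (auto simp: hit_def)

lemma card_sim_le_1:
  assumes "u \<in> P" "z \<in> P" "c \<in> L u"
  shows "card {d \<in> L z. c \<sim> d} \<le> 1"
proof -
  have "finite {d \<in> L z. c \<sim> d}" using finite_L assms by simp
  then show ?thesis
    using sim_unique[OF assms] by (auto simp: card_le_Suc0_iff_eq)
qed

lemma card_hit_le_adj:
  assumes "D \<subseteq> P" "z \<in> P" "\<And>d. d \<in> D \<Longrightarrow> \<phi> d \<in> L d"
  shows "card (hit D \<phi> z) \<le> card {d \<in> D. adj d z}"
proof -
  have fin: "finite {d \<in> D. adj d z}" using finite_sub_P[OF assms(1)] by simp
  have sub: "hit D \<phi> z \<subseteq> (\<Union>d\<in>{d \<in> D. adj d z}. {c \<in> L z. \<phi> d \<sim> c})"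
  proof
    fix c assume "c \<in> hit D \<phi> z"
    then obtain d where d: "d \<in> D" "c \<in> L z" "\<phi> d \<sim> c" by (auto simp: hit_def)
    then have "adj d z" using sim_adj[of d z "\<phi> d" c] assms by auto
    then show "c \<in> (\<Union>d\<in>{d \<in> D. adj d z}. {c \<in> L z. \<phi> d \<sim> c})" using d by auto
  qed
  have "card (hit D \<phi> z) \<le> card (\<Union>d\<in>{d \<in> D. adj d z}. {c \<in> L z. \<phi> d \<sim> c})"
    using sub fin finite_L[OF assms(2)] by (intro card_mono) auto
  also have "\<dots> \<le> (\<Sum>d\<in>{d \<in> D. adj d z}. card {c \<in> L z. \<phi> d \<sim> c})"
    using fin by (rule card_UN_le)
  also have "\<dots> \<le> (\<Sum>d\<in>{d \<in> D. adj d z}. 1)"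
  proof (rule sum_mono)
    fix d assume "d \<in> {d \<in> D. adj d z}"
    then show "card {c \<in> L z. \<phi> d \<sim> c} \<le> 1"
      using assms card_sim_le_1[of d z "\<phi> d"] by auto
  qed
  finally show ?thesis by simp
qed

lemma card_hit_le:
  assumes "D \<subseteq> P" "z \<in> P" "\<And>d. d \<in> D \<Longrightarrow> \<phi> d \<in> L d"
  shows "card (hit D \<phi> z) \<le> card D"
proof -
  have "card {d \<in> D. adj d z} \<le> card D"
    using finite_sub_P[OF assms(1)] by (intro card_mono) auto
  then show ?thesis using card_hit_le_adj[of D z \<phi>] assms by fastforce
qed

lemma card_hit_extend_adj:
  assumes "Z \<subseteq> P" "z \<in> P" "\<And>d. d \<in> Z \<Longrightarrow> \<psi> d \<in> L d" "\<And>d. d \<in> D \<Longrightarrow> \<psi> d = \<phi> d"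
  shows "card (hit (D \<union> Z) \<psi> z) \<le> card (hit D \<phi> z) + card {d \<in> Z. adj d z}"
proof -
  have "hit (D \<union> Z) \<psi> z = hit D \<phi> z \<union> hit Z \<psi> z"
    using hit_cong[of D \<psi> \<phi>] assms(4) by (simp add: hit_Un)
  then have "card (hit (D \<union> Z) \<psi> z) \<le> card (hit D \<phi> z) + card (hit Z \<psi> z)"
    by (simp add: card_Un_le)
  then show ?thesis using card_hit_le_adj[of Z z \<psi>] assms by fastforce
qed

lemma card_hit_extend:
  assumes "Z \<subseteq> P" "z \<in> P" "\<And>d. d \<in> Z \<Longrightarrow> \<psi> d \<in> L d" "\<And>d. d \<in> D \<Longrightarrow> \<psi> d = \<phi> d"
  shows "card (hit (D \<union> Z) \<psi> z) \<le> card (hit D \<phi> z) + card Z"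
proof -
  have "card {d \<in> Z. adj d z} \<le> card Z"
    using finite_sub_P[OF assms(1)] by (intro card_mono) auto
  then show ?thesis using card_hit_extend_adj[of Z z \<psi> D \<phi>] assms by fastforce
qed

lemma not_sim_self: "v \<in> P \<Longrightarrow> c \<in> L v \<Longrightarrow> d \<in> L v \<Longrightarrow> \<not> c \<sim> d"
  using sim_adj adj_irrefl by blast

lemma colors_Un:
  assumes "colors D \<phi>" "\<And>d. d \<in> D \<Longrightarrow> \<psi> d = \<phi> d"
    and "colors Z \<psi>" "D \<subseteq> P" "\<And>z. z \<in> Z \<Longrightarrow> \<psi> z \<notin> hit D \<phi> z"
  shows "colors (D \<union> Z) \<psi>"
  unfolding colors_def
proof (intro conjI ballI)
  fix v assume "v \<in> D \<union> Z"
  then show "\<psi> v \<in> L v" using assms unfolding colors_def by auto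
next
  have *: "\<not> \<psi> u \<sim> \<psi> v" if "u \<in> D" "v \<in> Z" for u v
    using assms that unfolding colors_def hit_def by auto
  fix u v assume "u \<in> D \<union> Z" "v \<in> D \<union> Z"
  then consider "u \<in> D" "v \<in> D" | "u \<in> D" "v \<in> Z" | "u \<in> Z" "v \<in> D" | "u \<in> Z" "v \<in> Z"
    by blast
  then show "\<not> \<psi> u \<sim> \<psi> v"
  proof cases
    case 1
    then show ?thesis using assms(1) assms(2)[of u] assms(2)[of v] by (simp add: colors_def)
  next
    case 2
    then show ?thesis by (rule *)
  next
    case 3
    then show ?thesis using *[of v u] sim_sym by blast
  next
    case 4
    then show ?thesis using assms(3) by (simp add: colors_def)
  qed
qed

text \<open>Any order works: when z is reached, it has lost the colours blocked by D and at most one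
  more for each neighbour in Z coloured before it. The subsets \<open>M z\<close> make it possible
  to colour from the noncanonical part of the lists alone.\<close>

lemma greedy_extend:
  assumes "colors D \<phi>" "D \<subseteq> P" "Z \<subseteq> P" "D \<inter> Z = {}"
    and "\<And>z. z \<in> Z \<Longrightarrow> M z \<subseteq> L z"
    and "\<And>z. z \<in> Z \<Longrightarrow> card (M z \<inter> hit D \<phi> z) + card {y \<in> Z. adj y z} < card (M z)"
  shows "\<exists>\<psi>. colors (D \<union> Z) \<psi> \<and> (\<forall>d\<in>D. \<psi> d = \<phi> d) \<and> (\<forall>z\<in>Z. \<psi> z \<in> M z)"
proof -
  have "finite Z" using assms(3) by (rule finite_sub_P)
  then show ?thesis using assms
  proof (induction Z arbitrary: D \<phi> rule: finite_induct)
    case empty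
    then show ?case by (intro exI[of _ \<phi>]) auto
  next
    case (insert z Z)
    have zP: "z \<in> P" and MzL: "M z \<subseteq> L z" using insert.prems by auto
    have fin: "finite (M z)" using MzL finite_L[OF zP] finite_subset by blast
    have "card (M z \<inter> hit D \<phi> z) < card (M z)" using insert.prems(6)[of z] by simp
    then have "M z \<inter> hit D \<phi> z \<noteq> M z" by auto
    then obtain c where c: "c \<in> M z" "c \<notin> hit D \<phi> z" by blast
    define \<phi>1 where "\<phi>1 = \<phi>(z := c)"
    have zD: "z \<notin> D" using insert.prems by auto
    have agree: "\<And>d. d \<in> D \<Longrightarrow> \<phi>1 d = \<phi> d" using zD by (auto simp: \<phi>1_def)
    have cL: "c \<in> L z" using c MzL by auto
    have "colors {z} \<phi>1"
      using cL not_sim_self[OF zP cL cL] unfolding colors_def \<phi>1_def by auto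
    then have col1: "colors (D \<union> {z}) \<phi>1"
      using colors_Un[of D \<phi> \<phi>1 "{z}"] insert.prems(1,2) agree c by (auto simp: \<phi>1_def)
    have step: "card (M y \<inter> hit (D \<union> {z}) \<phi>1 y) + card {w \<in> Z. adj w y} < card (M y)"
      if y: "y \<in> Z" for y
    proof -
      have yP: "y \<in> P" using y insert.prems by auto
      have "hit (D \<union> {z}) \<phi>1 y = hit D \<phi> y \<union> hit {z} \<phi>1 y"
        unfolding hit_Un using hit_cong[of D \<phi>1 \<phi>] agree by simp
      then have "card (M y \<inter> hit (D \<union> {z}) \<phi>1 y) \<le> card (M y \<inter> hit D \<phi> y) + card (M y \<inter> hit {z} \<phi>1 y)"
        by (simp add: Int_Un_distrib card_Un_le)
      moreover have "card (M y \<inter> hit {z} \<phi>1 y) \<le> card (hit {z} \<phi>1 y)"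
        using finite_hit[OF yP] by (intro card_mono) auto
      moreover have "card (hit {z} \<phi>1 y) \<le> card {d \<in> {z}. adj d y}"
        using zP yP cL by (intro card_hit_le_adj) (auto simp: \<phi>1_def)
      moreover have "card {w \<in> insert z Z. adj w y} = card {d \<in> {z}. adj d y} + card {w \<in> Z. adj w y}"
      proof -
        have "{w \<in> insert z Z. adj w y} = {d \<in> {z}. adj d y} \<union> {w \<in> Z. adj w y}" by auto
        then show ?thesis using insert.hyps by (simp add: card_Un_disjoint disjoint_iff)
      qed
      ultimately show ?thesis using insert.prems(6)[of y] y by simp
    qed
    have "\<exists>\<psi>. colors (D \<union> {z} \<union> Z) \<psi> \<and> (\<forall>d\<in>D \<union> {z}. \<psi> d = \<phi>1 d) \<and> (\<forall>z\<in>Z. \<psi> z \<in> M z)"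
      using insert.prems insert.hyps col1 step by (intro insert.IH) auto
    then obtain \<psi> where \<psi>: "colors (D \<union> {z} \<union> Z) \<psi>" "\<forall>d\<in>D \<union> {z}. \<psi> d = \<phi>1 d" "\<forall>z\<in>Z. \<psi> z \<in> M z"
      by blast
    show ?case
    proof (intro exI[of _ \<psi>] conjI)
      show "colors (D \<union> insert z Z) \<psi>" using \<psi>(1) by simp
      show "\<forall>d\<in>D. \<psi> d = \<phi> d" using \<psi>(2) agree by auto
      show "\<forall>y\<in>insert z Z. \<psi> y \<in> M y" using \<psi>(2,3) c by (auto simp: \<phi>1_def)
    qed
  qed
qed

lemma greedy_extend_full:
  assumes "colors D \<phi>" "D \<subseteq> P" "Z \<subseteq> P" "D \<inter> Z = {}"
    and "\<And>z. z \<in> Z \<Longrightarrow> card (hit D \<phi> z) + card {y \<in> Z. adj y z} < card (L z)"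
  shows "\<exists>\<psi>. colors (D \<union> Z) \<psi> \<and> (\<forall>d\<in>D. \<psi> d = \<phi> d)"
proof -
  have "\<And>z. L z \<inter> hit D \<phi> z = hit D \<phi> z" using hit_subset by blast
  then show ?thesis using greedy_extend[of D \<phi> Z L] assms by auto
qed

lemma card_others_less:
  assumes "Z \<subseteq> P" "z \<in> Z"
  shows "card {y \<in> Z. adj y z} < card Z"
proof (rule psubset_card_mono)
  show "finite Z" using assms(1) by (rule finite_sub_P)
  show "{y \<in> Z. adj y z} \<subset> Z" using assms(2) adj_irrefl[of z] by auto
qed

text \<open>The classes of f are treated one at a time, and all vertices of a class receive the same
  label. A class is independent, so no conflict arises inside it. Against the vertices coloured
  before, each v in S excludes at most \<open>card D + card S\<close> labels by injectivity, which
  explains the bound on \<open>card X\<close>. As labels factor through f via h, no more labels than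
  classes are used.\<close>

lemma label_extend:
  fixes f :: "'v \<Rightarrow> nat" and \<rho> :: "'x \<Rightarrow> 'v \<Rightarrow> 'c"
  assumes col: "colors D \<phi>" and DP: "D \<subseteq> P" and SP: "S \<subseteq> P" and DS: "D \<inter> S = {}"
    and f: "\<And>u v. \<lbrakk>u \<in> S; v \<in> S; adj u v\<rbrakk> \<Longrightarrow> f u \<noteq> f v"
    and \<rho>: "\<And>x v. \<lbrakk>x \<in> X; v \<in> S\<rbrakk> \<Longrightarrow> \<rho> x v \<in> L v"
    and inj: "\<And>v. v \<in> S \<Longrightarrow> inj_on (\<lambda>x. \<rho> x v) X"
    and X: "finite X" "card S * (card D + card S) < card X"
  shows "\<exists>\<psi> h. colors (D \<union> S) \<psi> \<and> (\<forall>d\<in>D. \<psi> d = \<phi> d) \<and>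
           (\<forall>v\<in>S. h (f v) \<in> X \<and> \<psi> v = \<rho> (h (f v)) v)"
proof -
  have finS: "finite S" using SP by (rule finite_sub_P)
  have main: "\<exists>\<psi> h. colors (D \<union> {v\<in>S. f v \<in> I}) \<psi> \<and> (\<forall>d\<in>D. \<psi> d = \<phi> d) \<and>
           (\<forall>v\<in>{v\<in>S. f v \<in> I}. h (f v) \<in> X \<and> \<psi> v = \<rho> (h (f v)) v)" if "finite I" for I
    using that
  proof (induction I rule: finite_induct)
    case empty
    then show ?case using col by (intro exI[of _ \<phi>]) auto
  next
    case (insert i I)
    let ?E = "D \<union> {v\<in>S. f v \<in> I}"
    obtain \<psi> h where IH: "colors ?E \<psi>" "\<forall>d\<in>D. \<psi> d = \<phi> d"
      "\<forall>v\<in>{v\<in>S. f v \<in> I}. h (f v) \<in> X \<and> \<psi> v = \<rho> (h (f v)) v"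
      using insert.IH by blast
    have EP: "?E \<subseteq> P" using DP SP by auto
    have cardE: "card ?E \<le> card D + card S"
    proof -
      have "card ?E \<le> card D + card {v\<in>S. f v \<in> I}" by (rule card_Un_le)
      also have "card {v\<in>S. f v \<in> I} \<le> card S" using finS by (intro card_mono) auto
      finally show ?thesis by simp
    qed
    let ?bad = "\<Union>v\<in>S. {x\<in>X. \<rho> x v \<in> hit ?E \<psi> v}"
    have "card ?bad \<le> (\<Sum>v\<in>S. card {x\<in>X. \<rho> x v \<in> hit ?E \<psi> v})"
      using finS by (rule card_UN_le)
    also have "\<dots> \<le> (\<Sum>v\<in>S. card D + card S)"
    proof (rule sum_mono)
      fix v assume v: "v \<in> S"
      have "card {x\<in>X. \<rho> x v \<in> hit ?E \<psi> v} \<le> card (hit ?E \<psi> v)"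
      proof (rule card_inj_on_le[where f = "\<lambda>x. \<rho> x v"])
        show "inj_on (\<lambda>x. \<rho> x v) {x\<in>X. \<rho> x v \<in> hit ?E \<psi> v}"
          using inj[OF v] by (rule inj_on_subset) auto
        show "finite (hit ?E \<psi> v)" using finite_hit v SP by auto
      qed auto
      also have "\<dots> \<le> card ?E"
        using EP v SP IH(1) by (intro card_hit_le) (auto simp: colors_def)
      finally show "card {x\<in>X. \<rho> x v \<in> hit ?E \<psi> v} \<le> card D + card S" using cardE by simp
    qed
    also have "\<dots> < card X" using X(2) by simp
    finally have "card ?bad < card X" .
    moreover have "finite ?bad" using finS X(1) by auto
    ultimately have "\<not> X \<subseteq> ?bad" using card_mono[of ?bad X] by linarith
    then obtain x where x: "x \<in> X" "x \<notin> ?bad" by blast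
    define \<psi>' where "\<psi>' = (\<lambda>v. if v \<in> S \<and> f v = i then \<rho> x v else \<psi> v)"
    have agree: "\<And>d. d \<in> ?E \<Longrightarrow> \<psi>' d = \<psi> d"
      using insert.hyps DS by (auto simp: \<psi>'_def)
    let ?Z = "{v\<in>S. f v = i}"
    have "colors ?Z \<psi>'"
      unfolding colors_def
    proof (intro conjI ballI)
      fix v assume "v \<in> ?Z" then show "\<psi>' v \<in> L v" using \<rho> x by (auto simp: \<psi>'_def)
    next
      fix u v assume uv: "u \<in> ?Z" "v \<in> ?Z"
      then have "\<psi>' u \<in> L u" "\<psi>' v \<in> L v" using \<rho> x by (auto simp: \<psi>'_def)
      then show "\<not> \<psi>' u \<sim> \<psi>' v" using sim_adj[of u v] f[of u v] uv SP by auto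
    qed
    then have "colors (?E \<union> ?Z) \<psi>'"
      using x by (intro colors_Un[OF IH(1) agree _ EP]) (auto simp: \<psi>'_def)
    moreover have "?E \<union> ?Z = D \<union> {v\<in>S. f v \<in> insert i I}" by auto
    ultimately have c: "colors (D \<union> {v\<in>S. f v \<in> insert i I}) \<psi>'" by simp
    show ?case
      by (rule exI[of _ \<psi>'], rule exI[of _ "h(i := x)"])
        (use c IH insert.hyps x DS in \<open>auto simp: \<psi>'_def\<close>)
  qed
  have "{v\<in>S. f v \<in> f ` S} = S" by auto
  then show ?thesis using main[of "f ` S"] finS by simp
qed

text \<open>Vertices sharing a label block the same colour of b. The loss at b is therefore counted
  by labels and not by vertices of S; this is how the chromatic number enters the estimates.\<close>

lemma card_hit_labels:
  assumes "b \<in> P" "S \<subseteq> P" "\<And>v. v \<in> S \<Longrightarrow> h v \<in> X \<and> \<phi> v = \<rho> (h v) v"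
    and "\<And>x v. \<lbrakk>x \<in> X; v \<in> S\<rbrakk> \<Longrightarrow> \<rho> x v \<in> L v \<and> \<rho> x b \<in> L b \<and> \<rho> x v \<sim> \<rho> x b"
  shows "hit S \<phi> b \<subseteq> (\<lambda>x. \<rho> x b) ` h ` S"
proof
  fix c assume "c \<in> hit S \<phi> b"
  then obtain v where v: "v \<in> S" "c \<in> L b" "\<phi> v \<sim> c" by (auto simp: hit_def)
  have "c = \<rho> (h v) b"
    using sim_unique[of v b "\<phi> v" c "\<rho> (h v) b"] assms v by auto
  then show "c \<in> (\<lambda>x. \<rho> x b) ` h ` S" using v by auto
qed

text \<open>
  If no r + 1 vertices of the clique S can be coloured, then any r coloured vertices block a
  whole r-element list, and hence each of them blocks a colour of its own.
\<close>
lemma clique_covered: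
  assumes S: "S \<subseteq> P" and M: "\<forall>v\<in>S. M v \<subseteq> L v \<and> card (M v) = r"
    and bad: "\<nexists>D \<phi>. D \<subseteq> S \<and> card D = Suc r \<and> colors D \<phi> \<and> (\<forall>v\<in>D. \<phi> v \<in> M v)"
    and rS: "r < card S"
    and D: "D \<subseteq> S - {w}" "colors D \<phi>" "\<forall>v\<in>D. \<phi> v \<in> M v" "card D \<le> r" "w \<in> S"
    and D': "D' \<subset> D" "\<And>c. \<lbrakk>c \<in> M w; c \<in> hit D \<phi> w\<rbrakk> \<Longrightarrow> c \<in> hit D' \<phi> w"
  shows False
proof -
  have finS: "finite S" using S by (rule finite_sub_P)
  have finD: "finite D" using D(1) finS finite_subset by blast
  have "card (S - {w}) = card S - 1" using D(5) finS by simp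
  then have "r - card D \<le> card (S - {w} - D)"
    using D(1) finD rS by (simp add: card_Diff_subset)
  \<comment> \<open>Z fills D up to r vertices, the number up to which greedy colouring from
    r-element sets is guaranteed to succeed.\<close>
  then obtain Z where Z: "Z \<subseteq> S - {w} - D" "card Z = r - card D"
    by (meson obtain_subset_with_card_n)
  have ZP: "Z \<subseteq> P" and DP: "D \<subseteq> P" and wP: "w \<in> P" using Z D S by auto
  have "\<exists>\<psi>. colors (D \<union> Z) \<psi> \<and> (\<forall>d\<in>D. \<psi> d = \<phi> d) \<and> (\<forall>z\<in>Z. \<psi> z \<in> M z)"
  proof (rule greedy_extend[OF D(2) DP ZP])
    fix z assume z: "z \<in> Z"
    then have zP: "z \<in> P" and zS: "z \<in> S" using ZP Z by auto
    show "M z \<subseteq> L z" using M zS by auto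
    have "card (M z \<inter> hit D \<phi> z) \<le> card (hit D \<phi> z)"
      using finite_hit[OF zP] by (intro card_mono) auto
    also have "\<dots> \<le> card D" using DP zP D(2) by (intro card_hit_le) (auto simp: colors_def)
    finally show "card (M z \<inter> hit D \<phi> z) + card {y \<in> Z. adj y z} < card (M z)"
      using card_others_less[OF ZP z] Z M[rule_format, OF zS] D(4) by linarith
  qed (use Z in auto)
  then obtain \<psi> where \<psi>: "colors (D \<union> Z) \<psi>" "\<forall>d\<in>D. \<psi> d = \<phi> d" "\<forall>z\<in>Z. \<psi> z \<in> M z" by blast
  have D'P: "D' \<subseteq> P" using D' DP by auto
  have \<psi>L: "\<psi> d \<in> L d" if "d \<in> D \<union> Z" for d using \<psi> that by (auto simp: colors_def)
  \<comment> \<open>At w, D' already does all the blocking of D inside \<open>M w\<close>. The r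
    coloured vertices thus block fewer than r colours there, and w becomes an additional coloured
    vertex.\<close>
  have hits: "M w \<inter> hit (D \<union> Z) \<psi> w \<subseteq> hit (D' \<union> Z) \<psi> w"
  proof
    fix c assume c: "c \<in> M w \<inter> hit (D \<union> Z) \<psi> w"
    have "hit D \<psi> w = hit D \<phi> w" using hit_cong \<psi>(2) by blast
    moreover have "hit D' \<psi> w = hit D' \<phi> w" using hit_cong \<psi>(2) D'(1) by blast
    ultimately show "c \<in> hit (D' \<union> Z) \<psi> w"
      using c D'(2)[of c] by (auto simp: hit_Un)
  qed
  have "card (M w \<inter> hit (D \<union> Z) \<psi> w) \<le> card (hit (D' \<union> Z) \<psi> w)"
    using hits finite_hit[OF wP] by (intro card_mono) auto
  also have "\<dots> \<le> card (D' \<union> Z)"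
    using D'P ZP wP D'(1) \<psi>L by (intro card_hit_le) auto
  also have "\<dots> \<le> card D' + card Z" by (rule card_Un_le)
  also have "\<dots> < card D + card Z" using psubset_card_mono[OF finD D'(1)] by simp
  also have "\<dots> = r" using Z D by simp
  finally have "card (M w \<inter> hit (D \<union> Z) \<psi> w) < card (M w)" using M D by simp
  then have "M w \<inter> hit (D \<union> Z) \<psi> w \<noteq> M w" by auto
  then obtain c where c: "c \<in> M w" "c \<notin> hit (D \<union> Z) \<psi> w" by blast
  let ?\<chi> = "\<psi>(w := c)"
  have wDZ: "w \<notin> D \<union> Z" using D Z by auto
  have cL: "c \<in> L w" using c M D by auto
  have "colors {w} ?\<chi>" using cL not_sim_self[OF wP cL cL] by (auto simp: colors_def)
  then have "colors ((D \<union> Z) \<union> {w}) ?\<chi>"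
    using wDZ c DP ZP by (intro colors_Un[OF \<psi>(1)]) auto
  moreover have "card ((D \<union> Z) \<union> {w}) = Suc r"
  proof -
    have "card (D \<union> Z) = card D + card Z"
      using finD finite_sub_P[OF ZP] Z by (intro card_Un_disjoint) auto
    then show ?thesis using wDZ finD finite_sub_P[OF ZP] Z D by simp
  qed
  moreover have "(D \<union> Z) \<union> {w} \<subseteq> S" using D Z by auto
  moreover have "\<forall>v\<in>(D \<union> Z) \<union> {w}. ?\<chi> v \<in> M v"
    using D(3) \<psi>(2,3) c(1) wDZ by auto
  ultimately show False using bad by blast
qed

text \<open>If c blocked nothing in \<open>M w\<close>, the empty set would block as much there as
  \<open>{u}\<close>, against \<open>clique_covered\<close>.\<close>

lemma clique_perfect:
  assumes S: "S \<subseteq> P" and M: "\<forall>v\<in>S. M v \<subseteq> L v \<and> card (M v) = r"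
    and bad: "\<nexists>D \<phi>. D \<subseteq> S \<and> card D = Suc r \<and> colors D \<phi> \<and> (\<forall>v\<in>D. \<phi> v \<in> M v)"
    and rS: "r < card S"
    and uw: "u \<in> S" "w \<in> S" "u \<noteq> w" "c \<in> M u"
  shows "\<exists>d\<in>M w. c \<sim> d"
proof (rule ccontr)
  assume no: "\<not> ?thesis"
  have uP: "u \<in> P" and cL: "c \<in> L u" using uw S M by auto
  have "finite (M u)" using M uw(1) finite_L[OF uP] finite_subset by blast
  then have "card {u} \<le> r" using M uw(1) uw(4) card_gt_0_iff[of "M u"] by auto
  from this uw(2) show False
  proof (rule clique_covered[OF S M bad rS, where D = "{u}" and w = w and \<phi> = "\<lambda>_. c" and D' = "{}", rotated 3])
    show "colors {u} (\<lambda>_. c)" using cL not_sim_self[OF uP cL cL] by (simp add: colors_def)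
    fix x assume "x \<in> M w" "x \<in> hit {u} (\<lambda>_. c) w"
    then show "x \<in> hit {} (\<lambda>_. c) w" using no by (auto simp: hit_def)
  qed (use uw in auto)
qed

text \<open>At w, each of c and d blocks only e. If both could be used together, \<open>{u}\<close>
  would block as much as \<open>{u, v}\<close>, against \<open>clique_covered\<close>.\<close>

lemma clique_triangle:
  assumes S: "S \<subseteq> P" and M: "\<forall>v\<in>S. M v \<subseteq> L v \<and> card (M v) = r"
    and bad: "\<nexists>D \<phi>. D \<subseteq> S \<and> card D = Suc r \<and> colors D \<phi> \<and> (\<forall>v\<in>D. \<phi> v \<in> M v)"
    and rS: "r < card S"
    and uvw: "u \<in> S" "v \<in> S" "w \<in> S" "u \<noteq> v" "u \<noteq> w" "v \<noteq> w"
    and c: "c \<in> M u" "d \<in> M v" "e \<in> M w" "c \<sim> e" "d \<sim> e"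
  shows "c \<sim> d"
proof (rule ccontr)
  assume no: "\<not> c \<sim> d"
  define \<phi> where "\<phi> = (\<lambda>x. if x = u then c else d)"
  have P: "u \<in> P" "v \<in> P" "w \<in> P" and cd: "c \<in> L u" "d \<in> L v" "e \<in> L w"
    using uvw S M c by auto
  have col: "colors {u, v} \<phi>"
    using cd no uvw not_sim_self P sim_sym by (auto simp: colors_def \<phi>_def)
  have \<phi>M: "\<forall>x\<in>{u, v}. \<phi> x \<in> M x" using c uvw by (auto simp: \<phi>_def)
  have c2: "card {u, v} = 2" using uvw by simp
  have "r \<noteq> 0" 
    using M uvw(1) c(1) finite_L[OF P(1)] by (metis card_0_eq empty_iff finite_subset)
  \<comment> \<open>For \<open>r = 1\<close> the vertices u and v, coloured by c and d, would
    already be \<open>Suc r\<close> coloured vertices.\<close>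
  moreover have "r \<noteq> 1" using bad col \<phi>M uvw c2
    by (metis One_nat_def Suc_1 empty_subsetI insert_subset)
  ultimately have "card {u, v} \<le> r" using c2 by simp
  from this uvw(3) show False
  proof (rule clique_covered[OF S M bad rS, where D = "{u, v}" and w = w and \<phi> = \<phi> and D' = "{u}", rotated 3])
    fix x assume "x \<in> M w" "x \<in> hit {u, v} \<phi> w"
    then have "x \<in> L w" "c \<sim> x \<or> d \<sim> x" by (auto simp: hit_def \<phi>_def split: if_splits)
    then have "x = e"
      using sim_unique[OF P(1) P(3) cd(1), of x e] sim_unique[OF P(2) P(3) cd(2), of x e] c cd by auto
    then show "x \<in> hit {u} \<phi> w" using c cd by (auto simp: hit_def \<phi>_def)
  qed (use uvw col \<phi>M in auto)
qed

section \<open>Recognising canonical covers\<close>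

lemma canonical_labelling:
  assumes \<sigma>: "\<And>v. v \<in> P \<Longrightarrow> bij_betw (\<sigma> v) L0 (L v)" and L0: "finite L0" "card L0 = q"
    and sim: "\<And>u v c. \<lbrakk>u \<in> P; v \<in> P; adj u v; c \<in> L0\<rbrakk> \<Longrightarrow> \<sigma> u c \<sim> \<sigma> v c"
  shows "\<exists>lam. (\<forall>v\<in>P. bij_betw lam (L v) {1..q}) \<and>
    (\<forall>u\<in>P. \<forall>v\<in>P. adj u v \<longrightarrow> (\<forall>c\<in>L u. \<forall>d\<in>L v. c \<sim> d \<longleftrightarrow> lam c = lam d))"
proof -
  obtain e where e: "bij_betw e L0 {1..q}"
    using L0 by (metis card_atLeastAtMost diff_Suc_1 finite_atLeastAtMost finite_same_card_bij)
  \<comment> \<open>Lists are disjoint, so a colour determines its vertex and the bijections at the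
    single vertices combine into one function on colours.\<close>
  define lam where "lam y = e (inv_into L0 (\<sigma> (THE v. v \<in> P \<and> y \<in> L v)) y)" for y
  have lam: "lam y = e (inv_into L0 (\<sigma> v) y)" if "v \<in> P" "y \<in> L v" for v y
  proof -
    have "(THE v. v \<in> P \<and> y \<in> L v) = v" using that L_disjoint by blast
    then show ?thesis by (simp add: lam_def)
  qed
  have lam\<sigma>: "lam (\<sigma> v c) = e c" if "v \<in> P" "c \<in> L0" for v c
  proof -
    have "\<sigma> v c \<in> L v" using \<sigma>[OF that(1)] that(2) by (rule bij_betwE[rule_format])
    then show ?thesis
      using lam[OF that(1)] \<sigma>[OF that(1)] that(2) by (simp add: bij_betw_def)
  qed
  show ?thesis
  proof (intro exI[of _ lam] conjI ballI impI)
    fix v assume v: "v \<in> P"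
    have "bij_betw (e \<circ> inv_into L0 (\<sigma> v)) (L v) {1..q}"
      using bij_betw_inv_into[OF \<sigma>[OF v]] e by (rule bij_betw_trans)
    then show "bij_betw lam (L v) {1..q}"
      by (rule bij_betw_cong[THEN iffD1, rotated]) (simp add: lam[OF v])
  next
    fix u v c d assume uv: "u \<in> P" "v \<in> P" "adj u v" and cd: "c \<in> L u" "d \<in> L v"
    obtain c0 where c0: "c0 \<in> L0" "c = \<sigma> u c0" using \<sigma>[OF uv(1)] cd by (auto simp: bij_betw_def)
    obtain d0 where d0: "d0 \<in> L0" "d = \<sigma> v d0" using \<sigma>[OF uv(2)] cd by (auto simp: bij_betw_def)
    have "lam c = lam d \<longleftrightarrow> c0 = d0"
      using lam\<sigma> uv c0 d0 e by (auto simp: bij_betw_def inj_on_def)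
    \<comment> \<open>The transversals supply a perfect matching between the lists of adjacent
      vertices; since a colour has at most one neighbour in a list, there is no room for other
      edges.\<close>
    moreover have "c \<sim> d \<longleftrightarrow> c0 = d0"
    proof
      assume "c \<sim> d"
      moreover have "c \<sim> \<sigma> v c0" using sim[OF uv c0(1)] c0 by simp
      moreover have "\<sigma> v c0 \<in> L v" using \<sigma>[OF uv(2)] c0(1) by (rule bij_betwE[rule_format])
      ultimately have "\<sigma> v c0 = \<sigma> v d0" using sim_unique uv cd d0 by blast
      then show "c0 = d0" using \<sigma>[OF uv(2)] c0 d0 by (auto simp: bij_betw_def inj_on_def)
    qed (use sim[OF uv c0(1)] c0 d0 in simp)
    ultimately show "c \<sim> d \<longleftrightarrow> lam c = lam d" by simp
  qed
qed

text \<open>The colours of a serve as labels and spread to every other vertex along their unique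
  neighbours. Injectivity at v is the matching property read from v back to a, and equal list sizes
  turn it into a bijection.\<close>

lemma canonical_from_neighbours:
  assumes a: "a \<in> P" and card_L: "\<And>v. v \<in> P \<Longrightarrow> card (L v) = q"
    and perfect: "\<And>v c. \<lbrakk>v \<in> P; v \<noteq> a; c \<in> L a\<rbrakk> \<Longrightarrow> \<exists>d\<in>L v. c \<sim> d"
    and triangle: "\<And>u v c d e. \<lbrakk>u \<in> P; v \<in> P; u \<noteq> a; v \<noteq> a; adj u v;
        c \<in> L a; d \<in> L u; e \<in> L v; c \<sim> d; c \<sim> e\<rbrakk> \<Longrightarrow> d \<sim> e"
  shows "\<exists>lam. (\<forall>v\<in>P. bij_betw lam (L v) {1..q}) \<and>
    (\<forall>u\<in>P. \<forall>v\<in>P. adj u v \<longrightarrow> (\<forall>c\<in>L u. \<forall>d\<in>L v. c \<sim> d \<longleftrightarrow> lam c = lam d))"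
proof -
  define \<sigma> where "\<sigma> v c = (if v = a then c else SOME d. d \<in> L v \<and> c \<sim> d)" for v c
  have \<sigma>: "\<sigma> v c \<in> L v \<and> c \<sim> \<sigma> v c" if "v \<in> P" "v \<noteq> a" "c \<in> L a" for v c
  proof -
    have "\<exists>d. d \<in> L v \<and> c \<sim> d" using perfect that by blast
    then show ?thesis unfolding \<sigma>_def using that(2) someI_ex[of "\<lambda>d. d \<in> L v \<and> c \<sim> d"] by simp
  qed
  have \<sigma>a: "\<sigma> a c = c" for c by (simp add: \<sigma>_def)
  have bij: "bij_betw (\<sigma> v) (L a) (L v)" if v: "v \<in> P" for v
  proof (cases "v = a")
    case True
    then show ?thesis by (simp add: \<sigma>a bij_betw_def inj_on_def)
  next
    case False
    have inj: "inj_on (\<sigma> v) (L a)"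
    proof (rule inj_onI)
      fix c d assume cd: "c \<in> L a" "d \<in> L a" "\<sigma> v c = \<sigma> v d"
      then have "\<sigma> v c \<sim> c" "\<sigma> v c \<sim> d" using \<sigma>[OF v False] sim_sym by metis+
      then show "c = d" using sim_unique[OF v a] \<sigma>[OF v False cd(1)] cd by blast
    qed
    moreover have "\<sigma> v ` L a \<subseteq> L v" using \<sigma>[OF v False] by auto
    moreover have "card (\<sigma> v ` L a) = card (L v)"
      using card_image[OF inj] card_L v a by simp
    ultimately show ?thesis
      using card_subset_eq[OF finite_L[OF v]] by (simp add: bij_betw_def)
  qed
  have sim: "\<sigma> u c \<sim> \<sigma> v c" if uv: "u \<in> P" "v \<in> P" "adj u v" and c: "c \<in> L a" for u v c
  proof -
    have "u \<noteq> v" using uv adj_irrefl by auto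
    then consider "u = a" "v \<noteq> a" | "v = a" "u \<noteq> a" | "u \<noteq> a" "v \<noteq> a" by blast
    then show ?thesis
    proof cases
      case 1
      then show ?thesis using \<sigma>[OF uv(2) _ c] \<sigma>a by simp
    next
      case 2
      then show ?thesis using \<sigma>[OF uv(1) _ c] \<sigma>a sim_sym by simp
    next
      case 3
      then show ?thesis using triangle[OF uv(1,2) 3 uv(3) c] \<sigma>[OF uv(1) _ c] \<sigma>[OF uv(2) _ c] by simp
    qed
  qed
  show ?thesis
    by (rule canonical_labelling[OF bij finite_L[OF a] card_L[OF a] sim])
qed

text \<open>This settles critical graphs without edges. The clique has one vertex more than there
  are colours in a list, so the clique lemmas apply with the full lists in the role of M.\<close>

lemma clique_canonical:
  assumes clique: "\<And>u v. \<lbrakk>u \<in> P; v \<in> P; u \<noteq> v\<rbrakk> \<Longrightarrow> adj u v"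
    and card_P: "card P = Suc q" and card_L: "\<And>v. v \<in> P \<Longrightarrow> card (L v) = q"
    and bad: "\<And>\<phi>. \<not> colors P \<phi>"
  shows "\<exists>lam. (\<forall>v\<in>P. bij_betw lam (L v) {1..q}) \<and>
    (\<forall>u\<in>P. \<forall>v\<in>P. adj u v \<longrightarrow> (\<forall>c\<in>L u. \<forall>d\<in>L v. c \<sim> d \<longleftrightarrow> lam c = lam d))"
proof -
  obtain a where a: "a \<in> P" using card_P by (metis card.empty ex_in_conv nat.distinct(1))
  have M: "\<forall>v\<in>P. L v \<subseteq> L v \<and> card (L v) = q" using card_L by simp
  have nocol: "\<nexists>D \<phi>. D \<subseteq> P \<and> card D = Suc q \<and> colors D \<phi> \<and> (\<forall>v\<in>D. \<phi> v \<in> L v)"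
    using bad card_P card_subset_eq[OF finite_P] by auto
  have lt: "q < card P" using card_P by simp
  show ?thesis
  proof (rule canonical_from_neighbours[OF a card_L])
    fix v c assume "v \<in> P" "v \<noteq> a" "c \<in> L a"
    then show "\<exists>d\<in>L v. c \<sim> d" using clique_perfect[OF subset_refl M nocol lt a, of v c] by auto
  next
    fix u v c d e
    assume *: "u \<in> P" "v \<in> P" "u \<noteq> a" "v \<noteq> a" "adj u v"
      "c \<in> L a" "d \<in> L u" "e \<in> L v" "c \<sim> d" "c \<sim> e"
    then have "u \<noteq> v" using adj_irrefl by auto
    then show "d \<sim> e"
      using clique_triangle[OF subset_refl M nocol lt *(1,2) a _ *(3,4,7,8,6)] * sim_sym by blast
  qed
qed

end

section \<open>Bad covers of the join of a critical graph and a large clique\<close>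

text \<open>Colourings of V are measured by the number of their values instead of a range, because
  they get composed with maps into labels and only the number of labels used counts. The list size
  \<open>k - 1 + t\<close> is one below the intended chromatic number \<open>k + t\<close> of the
  join.\<close>

locale join_cover = list_cover "V \<union> A" adj L sim
  for V A :: "'v set" and adj :: "'v \<Rightarrow> 'v \<Rightarrow> bool"
    and L :: "'v \<Rightarrow> 'c set" and sim :: "'c \<Rightarrow> 'c \<Rightarrow> bool" (infix \<open>\<sim>\<close> 50) +
  fixes k t m :: nat
  assumes V_A: "V \<inter> A = {}"
    and V_nonempty: "V \<noteq> {}"
    and adj_A: "\<lbrakk>a \<in> A; b \<in> A; a \<noteq> b\<rbrakk> \<Longrightarrow> adj a b"
    and adj_VA: "\<lbrakk>v \<in> V; a \<in> A\<rbrakk> \<Longrightarrow> adj v a"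
    and card_A: "card A = t"
    and card_L: "v \<in> V \<union> A \<Longrightarrow> card (L v) = k - 1 + t"
    and k_ge_2: "2 \<le> k"
    and vertex_critical: "v \<in> V \<Longrightarrow> \<exists>f :: 'v \<Rightarrow> nat. card (f ` (V - {v})) \<le> k - 1 \<and>
      (\<forall>x\<in>V - {v}. \<forall>y\<in>V - {v}. adj x y \<longrightarrow> f x \<noteq> f y)"
    and edge_critical: "\<lbrakk>u \<in> V; v \<in> V; adj u v\<rbrakk> \<Longrightarrow> \<exists>f :: 'v \<Rightarrow> nat. card (f ` V) \<le> k - 1 \<and>
      f u = f v \<and> (\<forall>x\<in>V. \<forall>y\<in>V. adj x y \<longrightarrow> {x, y} \<noteq> {u, v} \<longrightarrow> f x \<noteq> f y)"
    and degree_sum: "(\<Sum>v\<in>V. card {u \<in> V. adj u v}) \<le> 2 * m"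
    and card_V: "card V \<le> 2 * m"
    and k_le: "k \<le> 2 * m"
    and t_ge: "100 * m ^ 3 \<le> t"
    and not_colorable: "\<not> colors (V \<union> A) \<phi>"
begin

section \<open>Completing a colouring through A\<close>

lemma finite_V: "finite V" and finite_A: "finite A"
  using finite_P by auto

lemma m_pos: "0 < m"
  using card_V V_nonempty finite_V by (metis card_0_eq gr0I le_zero_eq mult_0_right)

text \<open>
  The vertices of A outside As have room to spare and are coloured first; within As only the
  very last vertex needs one colour more than the worst case leaves.
\<close>
lemma fill_A:
  assumes col: "colors (U \<union> D) \<phi>" and U: "U \<subseteq> V" and D: "D \<subseteq> A" and As: "As \<subseteq> A" "D \<inter> As = {}"
    and card_As: "card As = card V"
    and hits: "\<And>b. b \<in> As \<Longrightarrow> card (hit (U \<union> D) \<phi> b) \<le> k + card D"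
    and a: "a \<in> As" "card (hit (U \<union> D) \<phi> a) < k + card D"
  shows "\<exists>\<psi>. colors (U \<union> A) \<psi> \<and> (\<forall>v\<in>U \<union> D. \<psi> v = \<phi> v)"
proof -
  have finD: "finite D" using D finite_A by (rule finite_subset)
  have finAs: "finite As" using As(1) finite_A by (rule finite_subset)
  define Z1 where "Z1 = A - D - As"
  define Z2 where "Z2 = As - {a}"
  have UD: "U \<union> D \<subseteq> V \<union> A" using U D by auto
  have Z1P: "Z1 \<subseteq> V \<union> A" and Z2P: "Z2 \<subseteq> V \<union> A" using As by (auto simp: Z1_def Z2_def)
  have aA: "a \<in> A" using a As by auto
  have cZ1: "card Z1 + card D + card V = t"
  proof -
    have "card (D \<union> As) = card D + card V"
      using finD finAs As card_As by (simp add: card_Un_disjoint)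
    moreover have "card (A - (D \<union> As)) = card A - card (D \<union> As)"
      using finD finAs D As by (intro card_Diff_subset) auto
    moreover have "card (D \<union> As) \<le> card A" using D As finite_A by (intro card_mono) auto
    ultimately show ?thesis using card_A by (simp add: Z1_def Diff_eq Int_assoc)
  qed
  have cZ2: "Suc (card Z2) = card V"
    using a finAs card_As card_Suc_Diff1 unfolding Z2_def by metis
  have cUD: "card (U \<union> D) \<le> card V + card D"
    using card_mono[OF finite_V U] card_Un_le[of U D] by linarith
  have "\<exists>\<psi>. colors ((U \<union> D) \<union> Z1) \<psi> \<and> (\<forall>d\<in>U \<union> D. \<psi> d = \<phi> d)"
  proof (rule greedy_extend_full[OF col UD Z1P])
    show "(U \<union> D) \<inter> Z1 = {}" using U V_A by (auto simp: Z1_def)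
    fix z assume z: "z \<in> Z1"
    have "card (hit (U \<union> D) \<phi> z) \<le> card (U \<union> D)"
      using UD z Z1P col by (intro card_hit_le) (auto simp: colors_def)
    then show "card (hit (U \<union> D) \<phi> z) + card {y \<in> Z1. adj y z} < card (L z)"
      using card_others_less[OF Z1P z] cUD cZ1 card_L[of z] z Z1P by auto
  qed
  then obtain \<phi>1 where \<phi>1: "colors ((U \<union> D) \<union> Z1) \<phi>1" "\<forall>d\<in>U \<union> D. \<phi>1 d = \<phi> d" by blast
  have hit1: "card (hit ((U \<union> D) \<union> Z1) \<phi>1 z) \<le> card (hit (U \<union> D) \<phi> z) + card Z1"
    if "z \<in> V \<union> A" for z
    using \<phi>1 that Z1P by (intro card_hit_extend) (auto simp: colors_def)
  have "\<exists>\<psi>. colors ((U \<union> D \<union> Z1) \<union> Z2) \<psi> \<and> (\<forall>d\<in>U \<union> D \<union> Z1. \<psi> d = \<phi>1 d)"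
  proof (rule greedy_extend_full[OF \<phi>1(1) _ Z2P])
    show "U \<union> D \<union> Z1 \<subseteq> V \<union> A" using UD Z1P by auto
    show "(U \<union> D \<union> Z1) \<inter> Z2 = {}" using U V_A As by (auto simp: Z1_def Z2_def)
    fix z assume z: "z \<in> Z2"
    then have "z \<in> As" by (auto simp: Z2_def)
    \<comment> \<open>The loss is at most \<open>k + card D + card Z1\<close> plus
      \<open>card V - 2\<close> for the rest of \<open>Z2\<close>, in total
      \<open>k + t - 2\<close>.\<close>
    then show "card (hit (U \<union> D \<union> Z1) \<phi>1 z) + card {y \<in> Z2. adj y z} < card (L z)"
      using card_others_less[OF Z2P z] hit1[of z] hits[of z] cZ1 cZ2 card_L[of z] z Z2P k_ge_2 by auto
  qed
  then obtain \<phi>2 where \<phi>2: "colors ((U \<union> D \<union> Z1) \<union> Z2) \<phi>2" "\<forall>d\<in>U \<union> D \<union> Z1. \<phi>2 d = \<phi>1 d" by blast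
  have hit2: "card (hit (U \<union> D \<union> Z1 \<union> Z2) \<phi>2 a) \<le> card (hit (U \<union> D \<union> Z1) \<phi>1 a) + card Z2"
    using \<phi>2 aA Z2P by (intro card_hit_extend) (auto simp: colors_def)
  have "\<exists>\<psi>. colors ((U \<union> D \<union> Z1 \<union> Z2) \<union> {a}) \<psi> \<and> (\<forall>d\<in>U \<union> D \<union> Z1 \<union> Z2. \<psi> d = \<phi>2 d)"
  proof (rule greedy_extend_full[OF \<phi>2(1)])
    show "U \<union> D \<union> Z1 \<union> Z2 \<subseteq> V \<union> A" using UD Z1P Z2P by auto
    show "{a} \<subseteq> V \<union> A" using aA by auto
    show "(U \<union> D \<union> Z1 \<union> Z2) \<inter> {a} = {}" using U V_A aA a As by (auto simp: Z1_def Z2_def)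
    fix z assume z: "z \<in> {a}"
    have "{y \<in> {a}. adj y z} = {}" using z adj_irrefl by auto
    then have "card {y \<in> {a}. adj y z} = 0" by (simp only: card.empty)
    \<comment> \<open>All other vertices of As precede a, which costs one colour more than for a
      vertex of \<open>Z2\<close>; the strict bound assumed at a makes up for it.\<close>
    moreover have "card (hit (U \<union> D \<union> Z1 \<union> Z2) \<phi>2 z) < card (L z)"
      using z hit2 hit1[of a] a(2) cZ1 cZ2 card_L[of a] aA k_ge_2 by auto
    ultimately show "card (hit (U \<union> D \<union> Z1 \<union> Z2) \<phi>2 z) + card {y \<in> {a}. adj y z} < card (L z)"
      by linarith
  qed
  then obtain \<psi> where \<psi>: "colors ((U \<union> D \<union> Z1 \<union> Z2) \<union> {a}) \<psi>"
    "\<forall>d\<in>U \<union> D \<union> Z1 \<union> Z2. \<psi> d = \<phi>2 d" by blast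
  have "(U \<union> D \<union> Z1 \<union> Z2) \<union> {a} = U \<union> A" using D As a by (auto simp: Z1_def Z2_def)
  moreover have "\<forall>v\<in>U \<union> D. \<psi> v = \<phi> v" using \<psi>(2) \<phi>2(2) \<phi>1(2) by auto
  ultimately show ?thesis using \<psi>(1) by metis
qed

text \<open>The form in which badness is mostly used: once V is fully coloured, a single vertex of
  As that loses fewer colours than the worst case lets the colouring be completed.\<close>

lemma one_gain:
  assumes "colors (V \<union> D) \<phi>" "D \<subseteq> A" "As \<subseteq> A" "D \<inter> As = {}" "card As = card V"
    and "\<And>b. b \<in> As \<Longrightarrow> card (hit (V \<union> D) \<phi> b) \<le> k + card D"
    and "a \<in> As" "card (hit (V \<union> D) \<phi> a) < k + card D"
  shows False
  using fill_A[OF assms(1) subset_refl assms(2-8)] not_colorable by blast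

text \<open>
  The gain of v is \<open>card B - card (hit B \<phi> v)\<close>.  The state maximises the total gain, truncated at
  the degrees, among those using at most two vertices of A per unit of gain; U collects
  the vertices that are not yet saturated.
\<close>
lemma maximal_gain:
  obtains B \<phi> U where "B \<subseteq> A" "colors B \<phi>" "card B \<le> 4 * m" "U \<subseteq> V"
    "\<And>v. v \<in> V - U \<Longrightarrow> card {u \<in> V. adj u v} + card (hit B \<phi> v) \<le> card B"
    "\<And>u Z \<psi>. \<lbrakk>u \<in> U; Z \<subseteq> A - B; card Z \<le> 2; colors (B \<union> Z) \<psi>; \<And>b. b \<in> B \<Longrightarrow> \<psi> b = \<phi> b\<rbrakk>
        \<Longrightarrow> card (hit B \<phi> u) + card Z \<le> card (hit (B \<union> Z) \<psi> u)"
proof -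
  define deg where "deg v = card {u \<in> V. adj u v}" for v
  define pot where "pot = (\<lambda>(B, \<phi>). \<Sum>v\<in>V. min (card B - card (hit B \<phi> v)) (deg v))"
  \<comment> \<open>The factor 2 permits a step to spend two vertices on one unit of total gain. As
    the total never exceeds the degree sum, B keeps at most \<open>4 * m\<close> vertices.\<close>
  define ok where "ok = (\<lambda>(B, \<phi>). B \<subseteq> A \<and> colors B \<phi> \<and> card B \<le> 2 * pot (B, \<phi>))"
  have bound: "pot s \<le> 2 * m" for s
  proof -
    have "pot s \<le> (\<Sum>v\<in>V. deg v)" by (auto simp: pot_def split: prod.split intro!: sum_mono)
    then show ?thesis using degree_sum by (simp add: deg_def)
  qed
  have "ok ({}, undefined)" by (simp add: ok_def colors_def)
  then have "\<exists>s. ok s \<and> (\<forall>s'. ok s' \<longrightarrow> pot s' \<le> pot s)"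
    using bound by (intro ex_has_greatest_nat[where b = "Suc (2 * m)"]) (auto simp: less_Suc_eq_le)
  then obtain s where s: "ok s" "\<And>s'. ok s' \<Longrightarrow> pot s' \<le> pot s" by blast
  obtain B \<phi> where s_eq: "s = (B, \<phi>)" by (cases s)
  define U where "U = {v \<in> V. card B - card (hit B \<phi> v) < deg v}"
  have B: "B \<subseteq> A" "colors B \<phi>" "card B \<le> 2 * pot (B, \<phi>)"
    using s(1) by (simp_all add: ok_def s_eq)
  have finB: "finite B" using B finite_A finite_subset by auto
  have hitB: "card (hit B \<phi> v) \<le> card B" if "v \<in> V" for v
    using B that by (intro card_hit_le) (auto simp: colors_def)
  show ?thesis
  proof (rule that[of B \<phi> U])
    show "card B \<le> 4 * m" using B(3) bound[of "(B, \<phi>)"] by linarith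
    fix v assume "v \<in> V - U"
    then show "card {u \<in> V. adj u v} + card (hit B \<phi> v) \<le> card B"
      using hitB[of v] by (auto simp: U_def deg_def)
  next
    fix u Z \<psi>
    assume u: "u \<in> U" and Z: "Z \<subseteq> A - B" "card Z \<le> 2" and col: "colors (B \<union> Z) \<psi>"
      and agree: "\<And>b. b \<in> B \<Longrightarrow> \<psi> b = \<phi> b"
    show "card (hit B \<phi> u) + card Z \<le> card (hit (B \<union> Z) \<psi> u)"
    proof (rule ccontr)
      assume less: "\<not> ?thesis"
      have finZ: "finite Z" using Z finite_A finite_subset by auto
      have cBZ: "card (B \<union> Z) = card B + card Z"
        using finB finZ Z by (intro card_Un_disjoint) auto
      \<comment> \<open>A new vertex blocks at most one further colour in each list, so no gain
        decreases. Since u lies in U, truncation does not hide the increase at u and the total grows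
        strictly.\<close>
      have ext: "card (hit (B \<union> Z) \<psi> v) \<le> card (hit B \<phi> v) + card Z" if "v \<in> V" for v
        using Z that col agree by (intro card_hit_extend) (auto simp: colors_def)
      have uV: "u \<in> V" using u by (simp add: U_def)
      have "pot (B, \<phi>) < pot (B \<union> Z, \<psi>)"
        unfolding pot_def prod.case
      proof (rule sum_strict_mono_ex1[OF finite_V])
        show "\<forall>v\<in>V. min (card B - card (hit B \<phi> v)) (deg v)
            \<le> min (card (B \<union> Z) - card (hit (B \<union> Z) \<psi> v)) (deg v)"
        proof
          fix v assume "v \<in> V"
          then show "min (card B - card (hit B \<phi> v)) (deg v)
            \<le> min (card (B \<union> Z) - card (hit (B \<union> Z) \<psi> v)) (deg v)"
            using ext[of v] cBZ by auto
        qed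
        have "min (card B - card (hit B \<phi> u)) (deg u)
            < min (card (B \<union> Z) - card (hit (B \<union> Z) \<psi> u)) (deg u)"
          using less cBZ u hitB[OF uV] by (auto simp: U_def)
        then show "\<exists>v\<in>V. min (card B - card (hit B \<phi> v)) (deg v)
            < min (card (B \<union> Z) - card (hit (B \<union> Z) \<psi> v)) (deg v)" using uV by blast
      qed
      moreover from this have "ok (B \<union> Z, \<psi>)"
        using B Z cBZ col by (auto simp: ok_def)
      ultimately show False using s(2)[of "(B \<union> Z, \<psi>)"] s_eq by simp
    qed
  qed (use B in \<open>auto simp: U_def\<close>)
qed

text \<open>The budget of \<open>good_labels\<close>: the labels that must remain for
  \<open>label_extend\<close>, the colours of one vertex of A blocked by B, and the labels spoilt by
  the pairs from As and U. The three add up to at most \<open>32 * m ^ 3\<close>.\<close>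

lemma m_cube_bound: "12 * m ^ 2 + 4 * m + (2 * m) * ((2 * m) * (4 * m)) \<le> t"
proof -
  have "m \<le> m ^ 3" "m ^ 2 \<le> m ^ 3" using m_pos by (auto intro: self_le_power power_increasing)
  moreover have "(2 * m) * ((2 * m) * (4 * m)) = 16 * m ^ 3" by (simp add: power3_eq_cube)
  ultimately show ?thesis using t_ge by linarith
qed

text \<open>A label is a free colour x of one vertex a of As. It passes to u in U along its
  neighbour there, and from u on to the other vertices of As. Maximality makes these routes agree: a
  free colour without a neighbour at u, or two nonadjacent free colours with a common neighbour at
  u, would yield a gain. The agreement inside As is witnessed by a vertex of U, hence the condition
  that U be nonempty in the last clause. Edges inside U are left open; they need
  criticality.\<close>

lemma good_labels:
  obtains B \<phi> U As X and \<rho> :: "'c \<Rightarrow> 'v \<Rightarrow> 'c" where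
    "B \<subseteq> A" "colors B \<phi>" "card B \<le> 4 * m" "U \<subseteq> V"
    "\<And>v. v \<in> V - U \<Longrightarrow> card {u \<in> V. adj u v} + card (hit B \<phi> v) \<le> card B"
    "As \<subseteq> A - B" "card As = card V" "finite X" "12 * m ^ 2 < card X"
    "\<And>x u b. \<lbrakk>x \<in> X; u \<in> U; b \<in> As\<rbrakk> \<Longrightarrow> \<rho> x u \<in> L u \<and> \<rho> x b \<in> L b \<and> \<rho> x u \<sim> \<rho> x b"
    "\<And>u. u \<in> U \<Longrightarrow> inj_on (\<lambda>x. \<rho> x u) X"
    "\<And>x b b'. \<lbrakk>U \<noteq> {}; x \<in> X; b \<in> As; b' \<in> As; b \<noteq> b'\<rbrakk> \<Longrightarrow> \<rho> x b \<sim> \<rho> x b'"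
proof -
  obtain B \<phi> U where B: "B \<subseteq> A" "colors B \<phi>" "card B \<le> 4 * m" and U: "U \<subseteq> V"
    and sat: "\<And>v. v \<in> V - U \<Longrightarrow> card {u \<in> V. adj u v} + card (hit B \<phi> v) \<le> card B"
    and tight: "\<And>u Z \<psi>. \<lbrakk>u \<in> U; Z \<subseteq> A - B; card Z \<le> 2; colors (B \<union> Z) \<psi>; \<And>b. b \<in> B \<Longrightarrow> \<psi> b = \<phi> b\<rbrakk>
        \<Longrightarrow> card (hit B \<phi> u) + card Z \<le> card (hit (B \<union> Z) \<psi> u)"
    by (rule maximal_gain) blast
  have finB: "finite B" and BP: "B \<subseteq> V \<union> A" using B finite_A finite_subset by auto
  define F where "F b = L b - hit B \<phi> b" for b
  have FL: "F b \<subseteq> L b" for b by (auto simp: F_def)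
  have nbr: "\<exists>p\<in>L u. x \<sim> p" if b: "b \<in> A - B" and x: "x \<in> F b" and u: "u \<in> U" for b x u
  proof (rule ccontr)
    assume no: "\<not> ?thesis"
    let ?\<psi> = "\<phi>(b := x)"
    have xL: "x \<in> L b" using x FL by auto
    have bP: "b \<in> V \<union> A" using b by auto
    have "colors {b} ?\<psi>" using xL not_sim_self[OF bP xL xL] by (simp add: colors_def)
    then have col: "colors (B \<union> {b}) ?\<psi>"
      using b x BP by (intro colors_Un[OF B(2)]) (auto simp: F_def)
    have "hit {b} ?\<psi> u = {}" using no by (auto simp: hit_def)
    moreover have "hit B ?\<psi> u = hit B \<phi> u" using b by (intro hit_cong) auto
    ultimately have "card (hit (B \<union> {b}) ?\<psi> u) = card (hit B \<phi> u)"
      by (simp only: hit_Un Un_empty_right)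
    moreover have "card (hit B \<phi> u) + card {b} \<le> card (hit (B \<union> {b}) ?\<psi> u)"
      using b col by (intro tight[OF u]) auto
    ultimately show False by simp
  qed
  have pair: "x \<sim> y" if b: "b \<in> A - B" "b' \<in> A - B" "b \<noteq> b'" and xy: "x \<in> F b" "y \<in> F b'"
    and u: "u \<in> U" and p: "p \<in> L u" "x \<sim> p" "y \<sim> p" for b b' x y u p
  proof (rule ccontr)
    assume no: "\<not> x \<sim> y"
    let ?\<psi> = "\<phi>(b := x, b' := y)"
    have L: "x \<in> L b" "y \<in> L b'" using xy FL by auto
    have bP: "b \<in> V \<union> A" "b' \<in> V \<union> A" and uP: "u \<in> V \<union> A" using b u U by auto
    have "colors {b, b'} ?\<psi>"
      using L no sim_sym[of y x] b(3) not_sim_self[OF bP(1) L(1) L(1)] not_sim_self[OF bP(2) L(2) L(2)]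
      by (auto simp: colors_def)
    then have col: "colors (B \<union> {b, b'}) ?\<psi>"
      using b xy BP by (intro colors_Un[OF B(2)]) (auto simp: F_def)
    have "hit {b, b'} ?\<psi> u \<subseteq> {p}"
    proof
      fix c assume "c \<in> hit {b, b'} ?\<psi> u"
      then have c: "c \<in> L u" "x \<sim> c \<or> y \<sim> c" by (auto simp: hit_def split: if_splits)
      then show "c \<in> {p}"
        using sim_unique[OF bP(1) uP L(1) c(1) p(1)] sim_unique[OF bP(2) uP L(2) c(1) p(1)] p by auto
    qed
    then have "card (hit {b, b'} ?\<psi> u) \<le> 1" using card_mono[of "{p}"] by fastforce
    moreover have "hit B ?\<psi> u = hit B \<phi> u" using b by (intro hit_cong) auto
    ultimately have "card (hit (B \<union> {b, b'}) ?\<psi> u) \<le> card (hit B \<phi> u) + 1"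
      unfolding hit_Un using card_Un_le[of "hit B \<phi> u" "hit {b, b'} ?\<psi> u"] by simp
    moreover have "card (hit B \<phi> u) + card {b, b'} \<le> card (hit (B \<union> {b, b'}) ?\<psi> u)"
      using b col by (intro tight[OF u]) auto
    ultimately show False using b(3) by simp
  qed
  have "card V \<le> card (A - B)"
  proof -
    have "card (A - B) = t - card B" using B finB card_A by (simp add: card_Diff_subset)
    moreover have "2 * m \<le> (2 * m) * ((2 * m) * (4 * m))" using m_pos by simp
    ultimately show ?thesis using card_V B(3) m_cube_bound by linarith
  qed
  then obtain As where As: "As \<subseteq> A - B" "card As = card V" by (meson obtain_subset_with_card_n)
  then have "As \<noteq> {}" using V_nonempty finite_V by auto
  then obtain a where a: "a \<in> As" by blast
  have aAB: "a \<in> A - B" and aP: "a \<in> V \<union> A" using a As by auto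
  have finAs: "finite As" using As finite_A finite_subset by auto
  have finU: "finite U" using U finite_V finite_subset by auto
  \<comment> \<open>The colours of u where the route to b breaks off. Distinct free colours of b
    have distinct neighbours in \<open>L u\<close>, all lists are equally large, and
    \<open>F b\<close> lacks at most \<open>card B\<close> colours; so \<open>Q b u\<close> has at
    most \<open>card B\<close> elements. X collects the colours of a whose routes never break
    off.\<close>
  define Q where "Q b u = {p \<in> L u. \<not> (\<exists>y\<in>F b. y \<sim> p)}" for b u
  define X where "X = {x \<in> F a. \<forall>b\<in>As. \<forall>u\<in>U. \<forall>p\<in>L u. x \<sim> p \<longrightarrow> p \<notin> Q b u}"
  have cardF: "k - 1 + t \<le> card (F b) + card B" if "b \<in> A" for b
  proof -
    have bP: "b \<in> V \<union> A" using that by auto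
    have "card (hit B \<phi> b) \<le> card B"
      using BP bP B(2) by (intro card_hit_le) (auto simp: colors_def)
    moreover have "card (F b) = card (L b) - card (hit B \<phi> b)"
      unfolding F_def using hit_subset finite_hit[OF bP] by (intro card_Diff_subset)
    ultimately show ?thesis using card_L[OF bP] by linarith
  qed
  have cardQ: "card (Q b u) \<le> card B" if b: "b \<in> As" and u: "u \<in> U" for b u
  proof -
    have bA: "b \<in> A - B" and bP: "b \<in> V \<union> A" and uP: "u \<in> V \<union> A" using b u As U by auto
    have fin: "finite (L u - Q b u)" using finite_L[OF uP] by auto
    have "F b \<subseteq> (\<Union>p\<in>L u - Q b u. {y \<in> L b. p \<sim> y})"
    proof
      fix y assume y: "y \<in> F b"
      obtain p where p: "p \<in> L u" "y \<sim> p" using nbr[OF bA y u] by blast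
      then have "p \<in> L u - Q b u" using y by (auto simp: Q_def)
      moreover have "y \<in> {y \<in> L b. p \<sim> y}" using y p FL sim_sym by auto
      ultimately show "y \<in> (\<Union>p\<in>L u - Q b u. {y \<in> L b. p \<sim> y})" by (rule UN_I)
    qed
    then have "card (F b) \<le> card (\<Union>p\<in>L u - Q b u. {y \<in> L b. p \<sim> y})"
      using fin finite_L[OF bP] by (intro card_mono) auto
    also have "\<dots> \<le> (\<Sum>p\<in>L u - Q b u. card {y \<in> L b. p \<sim> y})" using fin by (rule card_UN_le)
    also have "\<dots> \<le> (\<Sum>p\<in>L u - Q b u. 1)"
    proof (rule sum_mono)
      fix p assume "p \<in> L u - Q b u"
      then show "card {y \<in> L b. p \<sim> y} \<le> 1" using card_sim_le_1[OF uP bP] by simp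
    qed
    also have "\<dots> = card (L u) - card (Q b u)"
      using finite_L[OF uP] by (simp add: card_Diff_subset Q_def)
    finally have "card (F b) \<le> card (L u) - card (Q b u)" .
    moreover have "card (Q b u) \<le> card (L u)"
      using finite_L[OF uP] by (intro card_mono) (auto simp: Q_def)
    ultimately show ?thesis using cardF[of b] card_L[OF uP] bA by auto
  qed
  have finF: "finite (F a)" using finite_L[OF aP] FL finite_subset by metis
  have cardX: "12 * m ^ 2 < card X"
  proof -
    define bad where "bad b u = {x \<in> F a. \<exists>p\<in>Q b u. x \<sim> p}" for b u
    have bad: "card (bad b u) \<le> card B" if b: "b \<in> As" and u: "u \<in> U" for b u
    proof -
      have uP: "u \<in> V \<union> A" using u U by auto
      have finQ: "finite (Q b u)" using finite_L[OF uP] by (auto simp: Q_def)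
      have "bad b u \<subseteq> (\<Union>p\<in>Q b u. {x \<in> L a. p \<sim> x})"
        unfolding bad_def using FL[of a] sim_sym by blast
      then have "card (bad b u) \<le> card (\<Union>p\<in>Q b u. {x \<in> L a. p \<sim> x})"
        using finQ finite_L[OF aP] by (intro card_mono) auto
      also have "\<dots> \<le> (\<Sum>p\<in>Q b u. card {x \<in> L a. p \<sim> x})" using finQ by (rule card_UN_le)
      also have "\<dots> \<le> (\<Sum>p\<in>Q b u. 1)"
      proof (rule sum_mono)
        fix p assume "p \<in> Q b u"
        then show "card {y \<in> L a. p \<sim> y} \<le> 1" using card_sim_le_1[OF uP aP] by (simp add: Q_def)
      qed
      finally show ?thesis using cardQ[OF b u] by simp
    qed
    have "F a \<subseteq> X \<union> (\<Union>b\<in>As. \<Union>u\<in>U. bad b u)"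
      unfolding X_def bad_def by blast
    then have "card (F a) \<le> card (X \<union> (\<Union>b\<in>As. \<Union>u\<in>U. bad b u))"
      using finF finAs finU by (intro card_mono) (auto simp: X_def bad_def)
    also have "\<dots> \<le> card X + card (\<Union>b\<in>As. \<Union>u\<in>U. bad b u)" by (rule card_Un_le)
    also have "card (\<Union>b\<in>As. \<Union>u\<in>U. bad b u) \<le> (\<Sum>b\<in>As. card (\<Union>u\<in>U. bad b u))"
      using finAs by (rule card_UN_le)
    also have "\<dots> \<le> (\<Sum>b\<in>As. \<Sum>u\<in>U. card (bad b u))"
      using finU by (intro sum_mono card_UN_le)
    also have "\<dots> \<le> (\<Sum>b\<in>As. \<Sum>u\<in>U. card B)"
      using bad by (intro sum_mono) auto
    also have "\<dots> = card V * (card U * card B)" using As by simp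
    also have "\<dots> \<le> (2 * m) * ((2 * m) * (4 * m))"
      using card_V B(3) card_mono[OF finite_V U] by (intro mult_mono) auto
    finally have "card (F a) \<le> card X + (2 * m) * ((2 * m) * (4 * m))" by simp
    then show ?thesis using cardF[of a] aAB B(3) m_cube_bound k_ge_2 by auto
  qed
  \<comment> \<open>For x in X the required neighbour exists at u in U by \<open>nbr\<close>, and at
    vertices of As by \<open>pair\<close> if U is nonempty. In the remaining cases the choice is
    arbitrary.\<close>
  define \<rho> where "\<rho> x v = (if v = a then x else SOME p. p \<in> L v \<and> x \<sim> p)" for x v
  have \<rho>a: "\<rho> x a = x" for x by (simp add: \<rho>_def)
  have \<rho>U: "\<rho> x u \<in> L u \<and> x \<sim> \<rho> x u" if "x \<in> X" "u \<in> U" for x u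
  proof -
    have "u \<noteq> a" using that U aAB V_A by auto
    moreover have "\<exists>p. p \<in> L u \<and> x \<sim> p" using nbr[OF aAB _ that(2), of x] that by (auto simp: X_def)
    ultimately show ?thesis
      unfolding \<rho>_def using someI_ex[of "\<lambda>p. p \<in> L u \<and> x \<sim> p"] by simp
  qed
  have \<rho>As: "\<rho> x b \<in> F b \<and> \<rho> x b \<sim> \<rho> x u \<and> (b \<noteq> a \<longrightarrow> x \<sim> \<rho> x b)"
    if x: "x \<in> X" and u: "u \<in> U" and b: "b \<in> As" for x u b
  proof (cases "b = a")
    case True
    then show ?thesis using \<rho>U[OF x u] x \<rho>a by (simp add: X_def)
  next
    case False
    have bAB: "b \<in> A - B" and bP: "b \<in> V \<union> A" using b As by auto
    have xF: "x \<in> F a" using x by (simp add: X_def)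
    obtain y where y: "y \<in> F b" "y \<sim> \<rho> x u"
      using x u b \<rho>U[OF x u] unfolding X_def Q_def by blast
    have xy: "x \<sim> y" using pair[OF aAB bAB _ xF y(1) u] \<rho>U[OF x u] y(2) False by auto
    then have ex: "\<exists>p. p \<in> L b \<and> x \<sim> p" using y FL by blast
    have "\<rho> x b \<in> L b \<and> x \<sim> \<rho> x b"
      unfolding \<rho>_def using someI_ex[OF ex] False by simp
    moreover have "x \<in> L a" "y \<in> L b" using xF y FL by auto
    ultimately have "\<rho> x b = y" using sim_unique[OF aP bP] xy by blast
    then show ?thesis using y xy by simp
  qed
  show ?thesis
  proof (rule that[OF B U sat As _ cardX, of \<rho>])
    show "finite X" using finF by (auto simp: X_def)
  next
    fix x u b assume "x \<in> X" "u \<in> U" "b \<in> As"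
    then show "\<rho> x u \<in> L u \<and> \<rho> x b \<in> L b \<and> \<rho> x u \<sim> \<rho> x b"
      using \<rho>U \<rho>As FL sim_sym by blast
  next
    fix u assume u: "u \<in> U"
    have uP: "u \<in> V \<union> A" using u U by auto
    show "inj_on (\<lambda>x. \<rho> x u) X"
    proof (rule inj_onI)
      fix x y assume xy: "x \<in> X" "y \<in> X" "\<rho> x u = \<rho> y u"
      then have "x \<in> L a" "y \<in> L a" using FL by (auto simp: X_def)
      moreover have "\<rho> x u \<sim> x" "\<rho> x u \<sim> y" using \<rho>U[OF xy(1) u] \<rho>U[OF xy(2) u] xy(3) sim_sym by auto
      ultimately show "x = y" using sim_unique[OF uP aP] \<rho>U[OF xy(1) u] by blast
    qed
  next
    fix x b b' assume *: "U \<noteq> {}" "x \<in> X" "b \<in> As" "b' \<in> As" "b \<noteq> b'"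
    then obtain u where u: "u \<in> U" by blast
    have "b \<in> A - B" "b' \<in> A - B" using * As by auto
    then show "\<rho> x b \<sim> \<rho> x b'"
      using pair[of b b' "\<rho> x b" "\<rho> x b'" u "\<rho> x u"] * u \<rho>As[OF *(2) u *(3)] \<rho>As[OF *(2) u *(4)]
        \<rho>U[OF *(2) u] by blast
  qed
qed

end

section \<open>Canonical labels on V and a few vertices of A\<close>

locale label_core = join_cover V A adj L sim k t m
  for V A :: "'v set" and adj :: "'v \<Rightarrow> 'v \<Rightarrow> bool"
    and L :: "'v \<Rightarrow> 'c set" and sim :: "'c \<Rightarrow> 'c \<Rightarrow> bool" (infix \<open>\<sim>\<close> 50)
    and k t m :: nat +
  fixes As :: "'v set" and X :: "'x set" and \<rho> :: "'x \<Rightarrow> 'v \<Rightarrow> 'c"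
  assumes As: "As \<subseteq> A" "card As = card V"
    and finite_X: "finite X" and card_X: "12 * m ^ 2 < card X"
    and \<rho>_L: "\<lbrakk>x \<in> X; p \<in> V \<union> As\<rbrakk> \<Longrightarrow> \<rho> x p \<in> L p"
    and \<rho>_sim: "\<lbrakk>x \<in> X; p \<in> V \<union> As; q \<in> V \<union> As; adj p q\<rbrakk> \<Longrightarrow> \<rho> x p \<sim> \<rho> x q"
    and \<rho>_inj: "v \<in> V \<Longrightarrow> inj_on (\<lambda>x. \<rho> x v) X"

context join_cover
begin

text \<open>The origin of \<open>12 * m ^ 2\<close>: at most \<open>2 * m\<close> vertices are to be
  labelled beside at most \<open>4 * m\<close> coloured ones, and
  \<open>2 * m * (4 * m + 2 * m)\<close> is this number.\<close>

lemma label_room: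
  assumes "12 * m ^ 2 < c" "s \<le> 2 * m" "d \<le> 4 * m"
  shows "s * (d + s) < c"
proof -
  have "s * (d + s) \<le> (2 * m) * (4 * m + 2 * m)"
    using assms by (intro mult_mono add_mono) auto
  then show ?thesis using assms(1) by (simp add: power2_eq_square)
qed

lemma card_sub_V: "S \<subseteq> V \<Longrightarrow> card S \<le> 2 * m"
  using card_mono[OF finite_V] card_V le_trans by blast

text \<open>Giving v a value of its own makes one colouring serve both counts: k values on V, and
  only \<open>k - 1\<close> once v is taken out.\<close>

lemma vertex_coloring:
  assumes "v \<in> V"
  obtains f :: "'v \<Rightarrow> nat" where "card (f ` (V - {v})) \<le> k - 1" "card (f ` V) \<le> k"
    "\<And>x y. \<lbrakk>x \<in> V; y \<in> V; adj x y\<rbrakk> \<Longrightarrow> f x \<noteq> f y"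
proof -
  obtain f :: "'v \<Rightarrow> nat" where f: "card (f ` (V - {v})) \<le> k - 1"
    "\<forall>x\<in>V - {v}. \<forall>y\<in>V - {v}. adj x y \<longrightarrow> f x \<noteq> f y"
    using vertex_critical[OF assms] by blast
  have "finite (f ` (V - {v}))" using finite_V by simp
  then obtain c where c: "c \<notin> f ` (V - {v})"
    using ex_new_if_finite infinite_UNIV_nat by blast
  have img: "(f(v := c)) ` (V - {v}) = f ` (V - {v})" by auto
  moreover have "(f(v := c)) ` V = insert c (f ` (V - {v}))" using assms by auto
  then have "card ((f(v := c)) ` V) \<le> Suc (card (f ` (V - {v})))"
    by (simp add: card_insert_if finite_V)
  then have "card ((f(v := c)) ` V) \<le> k" using f(1) k_ge_2 by linarith
  moreover have "(f(v := c)) x \<noteq> (f(v := c)) y" if "x \<in> V" "y \<in> V" "adj x y" for x y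
    using that f(2) c adj_irrefl by auto
  ultimately show ?thesis using f(1) by (intro that[of "f(v := c)"]) auto
qed

text \<open>Were the two colours not adjacent, V could be coloured as if the edge uv were absent:
  the class containing u and v takes the label x, the other classes take generic labels. This uses
  at most \<open>k - 1\<close> labels, so every vertex of As loses one colour less than the worst
  case.\<close>

lemma edge_labels:
  fixes \<rho> :: "'x \<Rightarrow> 'v \<Rightarrow> 'c"
  assumes As: "As \<subseteq> A" "card As = card V" and X: "finite X" "12 * m ^ 2 < card X"
    and \<rho>: "\<And>x v b. \<lbrakk>x \<in> X; v \<in> V; b \<in> As\<rbrakk> \<Longrightarrow> \<rho> x v \<in> L v \<and> \<rho> x b \<in> L b \<and> \<rho> x v \<sim> \<rho> x b"
    and inj: "\<And>v. v \<in> V \<Longrightarrow> inj_on (\<lambda>x. \<rho> x v) X"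
    and uv: "u \<in> V" "v \<in> V" "adj u v" and x: "x \<in> X"
  shows "\<rho> x u \<sim> \<rho> x v"
proof (rule ccontr)
  assume no: "\<not> \<rho> x u \<sim> \<rho> x v"
  have "As \<noteq> {}" using As V_nonempty finite_V by auto
  then obtain a where a: "a \<in> As" by blast
  obtain f :: "'v \<Rightarrow> nat" where f: "card (f ` V) \<le> k - 1" "f u = f v"
    "\<And>y z. \<lbrakk>y \<in> V; z \<in> V; adj y z; {y, z} \<noteq> {u, v}\<rbrakk> \<Longrightarrow> f y \<noteq> f z"
    using edge_critical[OF uv] by blast
  define W where "W = {w \<in> V. f w = f u}"
  have WV: "W \<subseteq> V" and uW: "u \<in> W" using uv by (auto simp: W_def)
  have \<rho>V: "\<rho> y w \<in> L w" if "y \<in> X" "w \<in> V" for y w using \<rho>[OF that a] by simp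
  have "colors W (\<rho> x)"
    unfolding colors_def
  proof (intro conjI ballI)
    fix w assume "w \<in> W"
    then show "\<rho> x w \<in> L w" using \<rho>V x WV by auto
  next
    fix y z assume yz: "y \<in> W" "z \<in> W"
    show "\<not> \<rho> x y \<sim> \<rho> x z"
    proof
      assume s: "\<rho> x y \<sim> \<rho> x z"
      have V: "y \<in> V" "z \<in> V" using yz WV by auto
      then have "adj y z" using sim_adj[OF _ _ \<rho>V[OF x V(1)] \<rho>V[OF x V(2)] s] by simp
      then have "{y, z} = {u, v}" using f(3)[of y z] yz WV by (auto simp: W_def)
      then show False using s no sim_sym by (auto simp: doubleton_eq_iff)
    qed
  qed
  then have "\<exists>\<psi> h. colors (W \<union> (V - W)) \<psi> \<and> (\<forall>d\<in>W. \<psi> d = \<rho> x d) \<and>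
      (\<forall>v\<in>V - W. h (f v) \<in> X \<and> \<psi> v = \<rho> (h (f v)) v)"
  proof (rule label_extend)
    show "f y \<noteq> f z" if "y \<in> V - W" "z \<in> V - W" "adj y z" for y z
    proof (rule f(3))
      show "{y, z} \<noteq> {u, v}" using that uW by auto
    qed (use that in auto)
    show "card (V - W) * (card W + card (V - W)) < card X"
      using card_sub_V[of "V - W"] card_sub_V[OF WV] by (intro label_room[OF X(2)]) auto
    show "inj_on (\<lambda>x. \<rho> x w) X" if "w \<in> V - W" for w using inj that by auto
  qed (use WV \<rho>V X in auto)
  then obtain \<psi> h where \<psi>: "colors (W \<union> (V - W)) \<psi>" "\<forall>d\<in>W. \<psi> d = \<rho> x d"
      "\<forall>v\<in>V - W. h (f v) \<in> X \<and> \<psi> v = \<rho> (h (f v)) v" by blast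
  \<comment> \<open>The class W contributes the single label x, which takes the place of the value
    \<open>f u\<close>; so H has no more values than f.\<close>
  define H where "H w = (if w \<in> W then x else h (f w))" for w
  have H: "H w \<in> X \<and> \<psi> w = \<rho> (H w) w" if "w \<in> V" for w
    using \<psi>(2,3) x that by (auto simp: H_def)
  have "H ` V \<subseteq> insert x (h ` (f ` V - {f u}))" by (auto simp: H_def W_def)
  then have "card (H ` V) \<le> card (insert x (h ` (f ` V - {f u})))"
    using finite_V by (intro card_mono) auto
  also have "\<dots> \<le> Suc (card (h ` (f ` V - {f u})))"
    using finite_V by (simp add: card_insert_if)
  also have "\<dots> \<le> Suc (card (f ` V - {f u}))"
    using finite_V by (simp add: card_image_le)
  also have "\<dots> = card (f ` V)" using finite_V uv by (intro card_Suc_Diff1) auto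
  finally have cH: "card (H ` V) \<le> k - 1" using f(1) by simp
  have hits: "card (hit V \<psi> b) < k" if b: "b \<in> As" for b
  proof -
    have "hit V \<psi> b \<subseteq> (\<lambda>x. \<rho> x b) ` H ` V"
      using H \<rho> b As by (intro card_hit_labels[where X = X]) auto
    then have "card (hit V \<psi> b) \<le> card ((\<lambda>x. \<rho> x b) ` H ` V)"
      using finite_V by (intro card_mono) auto
    also have "\<dots> \<le> card (H ` V)" using finite_V by (intro card_image_le) auto
    finally show ?thesis using cH k_ge_2 by linarith
  qed
  have "W \<union> (V - W) = V" using WV by auto
  then show False
    using one_gain[of "{}" \<psi> As a] \<psi>(1) As hits a by (simp add: less_imp_le)
qed

lemma core_exists:
  obtains As X and \<rho> :: "'c \<Rightarrow> 'v \<Rightarrow> 'c"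
  where "label_core V A adj L sim k t m As X \<rho>"
proof -
  obtain B \<phi> U As X and \<rho> :: "'c \<Rightarrow> 'v \<Rightarrow> 'c" where
    B: "B \<subseteq> A" "colors B \<phi>" "card B \<le> 4 * m" and U: "U \<subseteq> V" and
    sat: "\<And>v. v \<in> V - U \<Longrightarrow> card {u \<in> V. adj u v} + card (hit B \<phi> v) \<le> card B" and
    As: "As \<subseteq> A - B" "card As = card V" and X: "finite X" "12 * m ^ 2 < card X" and
    \<rho>: "\<And>x u b. \<lbrakk>x \<in> X; u \<in> U; b \<in> As\<rbrakk> \<Longrightarrow> \<rho> x u \<in> L u \<and> \<rho> x b \<in> L b \<and> \<rho> x u \<sim> \<rho> x b" and
    inj: "\<And>u. u \<in> U \<Longrightarrow> inj_on (\<lambda>x. \<rho> x u) X" and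
    \<rho>As: "\<And>x b b'. \<lbrakk>U \<noteq> {}; x \<in> X; b \<in> As; b' \<in> As; b \<noteq> b'\<rbrakk> \<Longrightarrow> \<rho> x b \<sim> \<rho> x b'"
    by (rule good_labels) blast
  have AsA: "As \<subseteq> A" using As by auto
  have finB: "finite B" using B(1) finite_A by (rule finite_subset)
  have finU: "finite U" using U finite_V by (rule finite_subset)
  have "As \<noteq> {}" using As V_nonempty finite_V by auto
  then obtain a where a: "a \<in> As" by blast
  have "U = V"
  proof (rule ccontr)
    assume "U \<noteq> V"
    then obtain v where v: "v \<in> V" "v \<notin> U" using U by blast
    obtain f :: "'v \<Rightarrow> nat" where f: "card (f ` (V - {v})) \<le> k - 1"
      "\<And>x y. \<lbrakk>x \<in> V; y \<in> V; adj x y\<rbrakk> \<Longrightarrow> f x \<noteq> f y"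
      using vertex_coloring[OF v(1)] by blast
    have "f ` U \<subseteq> f ` (V - {v})" using U v by auto
    then have cf: "card (f ` U) \<le> k - 1"
      using f(1) card_mono[of "f ` (V - {v})" "f ` U"] finite_V by auto
    have "\<exists>\<psi> h. colors (B \<union> U) \<psi> \<and> (\<forall>d\<in>B. \<psi> d = \<phi> d) \<and>
        (\<forall>v\<in>U. h (f v) \<in> X \<and> \<psi> v = \<rho> (h (f v)) v)"
    proof (rule label_extend[OF B(2)])
      show "card U * (card B + card U) < card X"
        using card_sub_V[OF U] B(3) by (intro label_room[OF X(2)])
      show "B \<inter> U = {}" using B U V_A by auto
      show "f x \<noteq> f y" if "x \<in> U" "y \<in> U" "adj x y" for x y using f(2)[of x y] that U by auto
    qed (use B U \<rho> a X inj in auto)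
    then obtain \<psi> h where \<psi>: "colors (B \<union> U) \<psi>" "\<forall>d\<in>B. \<psi> d = \<phi> d"
        "\<forall>v\<in>U. h (f v) \<in> X \<and> \<psi> v = \<rho> (h (f v)) v" by blast
    have hits: "card (hit (U \<union> B) \<psi> b) < k + card B" if b: "b \<in> As" for b
    proof -
      have bP: "b \<in> V \<union> A" using b AsA by auto
      have "hit U \<psi> b \<subseteq> (\<lambda>x. \<rho> x b) ` (\<lambda>v. h (f v)) ` U"
        using \<psi>(3) \<rho> b bP U by (intro card_hit_labels[where X = X]) auto
      then have "card (hit U \<psi> b) \<le> card ((\<lambda>x. \<rho> x b) ` h ` f ` U)"
        using finU by (intro card_mono) (auto simp: image_image)
      also have "\<dots> \<le> card (f ` U)"
        using finU by (meson card_image_le finite_imageI le_trans)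
      finally have 1: "card (hit U \<psi> b) \<le> k - 1" using cf by simp
      have "card (hit B \<psi> b) \<le> card B"
        using B \<psi>(1) bP by (intro card_hit_le) (auto simp: colors_def)
      then show ?thesis
        unfolding hit_Un using 1 card_Un_le[of "hit U \<psi> b" "hit B \<psi> b"] k_ge_2 by linarith
    qed
    have "\<exists>\<chi>. colors (U \<union> A) \<chi> \<and> (\<forall>v\<in>U \<union> B. \<chi> v = \<psi> v)"
      using \<psi>(1) U B As hits a by (intro fill_A[where As = As and a = a]) (auto simp: Un_commute less_imp_le)
    then obtain \<chi> where \<chi>: "colors (U \<union> A) \<chi>" "\<forall>v\<in>U \<union> B. \<chi> v = \<psi> v" by blast
    have "\<exists>\<xi>. colors ((U \<union> A) \<union> (V - U)) \<xi> \<and> (\<forall>d\<in>U \<union> A. \<xi> d = \<chi> d)"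
    proof (rule greedy_extend_full[OF \<chi>(1)])
      fix z assume z: "z \<in> V - U"
      have zP: "z \<in> V \<union> A" using z by auto
      have "hit A \<chi> z = hit B \<chi> z \<union> hit (A - B) \<chi> z"
        using B(1) hit_Un[of B "A - B" \<chi> z] by (simp add: Un_absorb1)
      moreover have "hit B \<chi> z = hit B \<phi> z" using \<chi>(2) \<psi>(2) by (intro hit_cong) auto
      ultimately have "card (hit A \<chi> z) \<le> card (hit B \<phi> z) + card (hit (A - B) \<chi> z)"
        by (simp add: card_Un_le)
      moreover have "card (hit (A - B) \<chi> z) \<le> card (A - B)"
        using zP \<chi>(1) by (intro card_hit_le) (auto simp: colors_def)
      moreover have "card (A - B) = t - card B" using B(1) finB card_A by (simp add: card_Diff_subset)
      moreover have "card B \<le> t" using B(1) card_A finite_A card_mono by metis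
      moreover have "card (hit U \<chi> z) \<le> card {u \<in> U. adj u z}"
        using zP U \<chi>(1) by (intro card_hit_le_adj) (auto simp: colors_def)
      moreover have "card (hit (U \<union> A) \<chi> z) \<le> card (hit U \<chi> z) + card (hit A \<chi> z)"
        unfolding hit_Un by (rule card_Un_le)
      moreover have "card {u \<in> V. adj u z} = card {u \<in> U. adj u z} + card {y \<in> V - U. adj y z}"
      proof -
        have "{u \<in> V. adj u z} = {u \<in> U. adj u z} \<union> {y \<in> V - U. adj y z}" using U by auto
        moreover have "finite {u \<in> U. adj u z}" "finite {y \<in> V - U. adj y z}"
          using finU finite_V by auto
        moreover have "{u \<in> U. adj u z} \<inter> {y \<in> V - U. adj y z} = {}" by auto
        ultimately show ?thesis by (metis card_Un_disjoint)
      qed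
      \<comment> \<open>With d the degree of z inside V, B blocks at most \<open>card B - d\<close>
        colours because z is saturated, the rest of A at most \<open>t - card B\<close>, and the
        vertices of V account for at most d. The sum t is below the list size because
        \<open>2 \<le> k\<close>.\<close>
      ultimately show "card (hit (U \<union> A) \<chi> z) + card {y \<in> V - U. adj y z} < card (L z)"
        using sat[OF z] card_L[OF zP] k_ge_2 by linarith
    qed (use U V_A in auto)
    moreover have "(U \<union> A) \<union> (V - U) = V \<union> A" using U by auto
    ultimately show False using not_colorable by auto
  qed
  \<comment> \<open>B and its colours have served their purpose; only the labels found with their
    help are kept.\<close>
  note \<rho>' = \<rho>[unfolded \<open>U = V\<close>] and inj' = inj[unfolded \<open>U = V\<close>]
  have core: "label_core V A adj L sim k t m As X \<rho>"
  proof
    show "As \<subseteq> A" by (rule AsA)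
    fix x p q assume x: "x \<in> X" and p: "p \<in> V \<union> As" and q: "q \<in> V \<union> As" and pq: "adj p q"
    have "p \<noteq> q" using pq adj_irrefl by auto
    consider "p \<in> V" "q \<in> V" | "p \<in> V" "q \<in> As" | "p \<in> As" "q \<in> V" | "p \<in> As" "q \<in> As"
      using p q by blast
    then show "\<rho> x p \<sim> \<rho> x q"
    proof cases
      case 1
      then show ?thesis using edge_labels[OF AsA As(2) X \<rho>' inj'] pq x by blast
    next
      case 2
      then show ?thesis using \<rho>'[OF x] by blast
    next
      case 3
      then show ?thesis using \<rho>'[OF x] sim_sym by blast
    next
      case 4
      then show ?thesis using \<rho>As x \<open>U = V\<close> V_nonempty \<open>p \<noteq> q\<close> by blast
    qed
  next
    fix x p assume x: "x \<in> X" "p \<in> V \<union> As"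
    obtain v where "v \<in> V" using V_nonempty by blast
    then show "\<rho> x p \<in> L p" using \<rho>'[OF x(1)] x(2) a by blast
  qed (use As X inj' in auto)
  then show ?thesis by (rule that)
qed

end

section \<open>Extending the labels to the rest of A\<close>

context label_core
begin

lemma As_nonempty: "As \<noteq> {}"
  using As V_nonempty finite_V by auto

lemma \<rho>_VAs: "\<lbrakk>x \<in> X; v \<in> V; b \<in> As\<rbrakk> \<Longrightarrow> \<rho> x v \<in> L v \<and> \<rho> x b \<in> L b \<and> \<rho> x v \<sim> \<rho> x b"
  using \<rho>_L \<rho>_sim adj_VA As by blast

text \<open>
  The vertices of V outside C receive generic labels, which avoid all conflicts with the
  prescribed colours.
\<close>
lemma no_gain:
  fixes f :: "'v \<Rightarrow> nat"
  assumes col: "colors (C \<union> D) \<phi>" and C: "C \<subseteq> V" and D: "D \<subseteq> A - As" "card D \<le> 2" "card C \<le> 1"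
    and f: "\<And>x y. \<lbrakk>x \<in> V - C; y \<in> V - C; adj x y\<rbrakk> \<Longrightarrow> f x \<noteq> f y"
    and cf: "card (f ` (V - C)) + card C \<le> k"
    and a: "a \<in> As" "card (hit (C \<union> D) \<phi> a) < card C + card D"
  shows False
proof -
  have finC: "finite C" using C finite_V by (rule finite_subset)
  have CD: "C \<union> D \<subseteq> V \<union> A" using C D by auto
  have cCD: "card (C \<union> D) \<le> 4 * m"
    using card_Un_le[of C D] D m_pos by linarith
  have "\<exists>\<psi> h. colors ((C \<union> D) \<union> (V - C)) \<psi> \<and> (\<forall>d\<in>C \<union> D. \<psi> d = \<phi> d) \<and>
        (\<forall>v\<in>V - C. h (f v) \<in> X \<and> \<psi> v = \<rho> (h (f v)) v)"
  proof (rule label_extend[OF col CD])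
    show "(C \<union> D) \<inter> (V - C) = {}" using D V_A by auto
    show "card (V - C) * (card (C \<union> D) + card (V - C)) < card X"
      using card_sub_V[of "V - C"] cCD by (intro label_room[OF card_X]) auto
  qed (use f \<rho>_L \<rho>_inj finite_X in auto)
  then obtain \<psi> h where \<psi>: "colors ((C \<union> D) \<union> (V - C)) \<psi>" "\<forall>d\<in>C \<union> D. \<psi> d = \<phi> d"
        "\<forall>v\<in>V - C. h (f v) \<in> X \<and> \<psi> v = \<rho> (h (f v)) v" by blast
  have VD: "(C \<union> D) \<union> (V - C) = V \<union> D" using C by auto
  \<comment> \<open>The labels on \<open>V - C\<close> block at most \<open>k - card C\<close>
    colours of b, so a shortfall of \<open>C \<union> D\<close> below \<open>card C + card D\<close>
    is passed on undiminished to \<open>V \<union> D\<close>.\<close>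
  have hits: "card (hit (V \<union> D) \<psi> b) + card C \<le> k + card (hit (C \<union> D) \<phi> b)" if b: "b \<in> As" for b
  proof -
    have bP: "b \<in> V \<union> A" using b As by auto
    have "hit (V - C) \<psi> b \<subseteq> (\<lambda>x. \<rho> x b) ` (\<lambda>v. h (f v)) ` (V - C)"
      using \<psi>(3) \<rho>_VAs b bP by (intro card_hit_labels[where X = X]) auto
    then have "card (hit (V - C) \<psi> b) \<le> card ((\<lambda>x. \<rho> x b) ` h ` f ` (V - C))"
      using finite_V by (intro card_mono) (auto simp: image_image)
    also have "\<dots> \<le> card (f ` (V - C))"
      using finite_V by (meson card_image_le finite_imageI finite_Diff le_trans)
    finally have "card (hit (V - C) \<psi> b) + card C \<le> k" using cf by linarith
    moreover have "hit (C \<union> D) \<psi> b = hit (C \<union> D) \<phi> b" using \<psi>(2) by (intro hit_cong) auto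
    moreover have "hit (V \<union> D) \<psi> b = hit (C \<union> D) \<psi> b \<union> hit (V - C) \<psi> b"
      unfolding VD[symmetric] by (rule hit_Un)
    ultimately show ?thesis using card_Un_le[of "hit (C \<union> D) \<phi> b" "hit (V - C) \<psi> b"] by simp
  qed
  show False
  proof (rule one_gain[of D \<psi> As a])
    show "colors (V \<union> D) \<psi>" using \<psi>(1) VD by simp
    show "card (hit (V \<union> D) \<psi> a) < k + card D" using hits[OF a(1)] a(2) by linarith
    fix b assume b: "b \<in> As"
    have "b \<in> V \<union> A" using b As by auto
    then have "card (hit (C \<union> D) \<phi> b) \<le> card (C \<union> D)"
      using CD col by (intro card_hit_le) (auto simp: colors_def)
    then have "card (hit (C \<union> D) \<phi> b) \<le> card C + card D" using card_Un_le[of C D] by linarith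
    then show "card (hit (V \<union> D) \<psi> b) \<le> k + card D" using hits[OF b] by linarith
  qed (use D As a in auto)
qed

text \<open>A colour z that blocks nothing in \<open>L a\<close> would itself be the gain, with
  generic labels on all of V.\<close>

lemma outside_neighbour:
  assumes w: "w \<in> A - As" and z: "z \<in> L w" and a: "a \<in> As"
  shows "\<exists>y\<in>L a. z \<sim> y"
proof (rule ccontr)
  assume no: "\<not> ?thesis"
  obtain v where v: "v \<in> V" using V_nonempty by blast
  obtain f :: "'v \<Rightarrow> nat" where f: "card (f ` V) \<le> k"
    "\<And>x y. \<lbrakk>x \<in> V; y \<in> V; adj x y\<rbrakk> \<Longrightarrow> f x \<noteq> f y"
    using vertex_coloring[OF v] by blast
  have wP: "w \<in> V \<union> A" using w by auto
  have "hit {w} (\<lambda>_. z) a = {}" using no by (auto simp: hit_def)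
  then show False
    using w f z not_sim_self[OF wP z z]
    by (intro no_gain[of "{}" "{w}" "\<lambda>_. z" f a]) (auto simp: colors_def a)
qed

text \<open>Otherwise z and \<open>\<rho> x v\<close> could be used together, although both block
  the same colour \<open>\<rho> x a\<close>. Prescribing a colour at v costs nothing extra, because
  by criticality the rest of V needs only \<open>k - 1\<close> labels.\<close>

lemma outside_label:
  assumes w: "w \<in> A - As" and z: "z \<in> L w" and a: "a \<in> As" and x: "x \<in> X"
    and za: "z \<sim> \<rho> x a" and v: "v \<in> V"
  shows "z \<sim> \<rho> x v"
proof (rule ccontr)
  assume no: "\<not> z \<sim> \<rho> x v"
  obtain f :: "'v \<Rightarrow> nat" where f: "card (f ` (V - {v})) \<le> k - 1"
    "\<And>x y. \<lbrakk>x \<in> V; y \<in> V; adj x y\<rbrakk> \<Longrightarrow> f x \<noteq> f y"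
    using vertex_coloring[OF v] by blast
  have "Suc (card (f ` (V - {v}))) \<le> k" using f(1) k_ge_2 by linarith
  have P: "w \<in> V \<union> A" "v \<in> V \<union> A" "a \<in> V \<union> A" using w v a As by auto
  have vw: "v \<noteq> w" using v w V_A by auto
  have L: "\<rho> x v \<in> L v" "\<rho> x a \<in> L a" and va: "\<rho> x v \<sim> \<rho> x a" using \<rho>_VAs x v a by auto
  define \<phi> where "\<phi> u = (if u = v then \<rho> x v else z)" for u
  have col: "colors ({v} \<union> {w}) \<phi>"
    using L z no sim_sym[of "\<rho> x v" z] not_sim_self[OF P(1) z z] not_sim_self[OF P(2) L(1) L(1)] vw
    by (auto simp: colors_def \<phi>_def)
  have "hit ({v} \<union> {w}) \<phi> a \<subseteq> {\<rho> x a}"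
  proof
    fix c assume "c \<in> hit ({v} \<union> {w}) \<phi> a"
    then have c: "c \<in> L a" "\<rho> x v \<sim> c \<or> z \<sim> c" by (auto simp: hit_def \<phi>_def split: if_splits)
    then show "c \<in> {\<rho> x a}"
      using sim_unique[OF P(2,3) L(1) c(1) L(2)] sim_unique[OF P(1,3) z c(1) L(2)] va za by auto
  qed
  then have "card (hit ({v} \<union> {w}) \<phi> a) \<le> 1" using card_mono[of "{\<rho> x a}"] by fastforce
  then show False
    using no_gain[OF col, of f a] w v a f(2) \<open>Suc (card (f ` (V - {v}))) \<le> k\<close> by auto
qed

text \<open>By \<open>outside_neighbour\<close> every colour of w is matched into
  \<open>L a\<close>, and equal list sizes make this matching onto; so each label at a comes from a
  colour of w. The colours obtained from different vertices of As coincide, since all are adjacent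
  to one and the same label at a vertex of V.\<close>

lemma outside_extension:
  assumes w: "w \<in> A - As" and x: "x \<in> X"
  shows "\<exists>z\<in>L w. \<forall>p\<in>V \<union> As. z \<sim> \<rho> x p"
proof -
  have wP: "w \<in> V \<union> A" using w by auto
  have surj: "\<exists>z\<in>L w. z \<sim> \<rho> x a" if a: "a \<in> As" for a
  proof -
    have aP: "a \<in> V \<union> A" using a As by auto
    define Y where "Y = {y \<in> L a. \<exists>z\<in>L w. z \<sim> y}"
    have YL: "Y \<subseteq> L a" and finY: "finite Y" using finite_L[OF aP] by (auto simp: Y_def)
    have "L w \<subseteq> (\<Union>y\<in>Y. {z \<in> L w. y \<sim> z})"
    proof
      fix z assume z: "z \<in> L w"
      then obtain y where "y \<in> L a" "z \<sim> y" using outside_neighbour[OF w z a] by blast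
      then show "z \<in> (\<Union>y\<in>Y. {z \<in> L w. y \<sim> z})" using z sim_sym by (auto simp: Y_def)
    qed
    then have "card (L w) \<le> card (\<Union>y\<in>Y. {z \<in> L w. y \<sim> z})"
      using finY finite_L[OF wP] by (intro card_mono) auto
    also have "\<dots> \<le> (\<Sum>y\<in>Y. card {z \<in> L w. y \<sim> z})" using finY by (rule card_UN_le)
    also have "\<dots> \<le> (\<Sum>y\<in>Y. 1)"
    proof (rule sum_mono)
      fix y assume "y \<in> Y"
      then show "card {z \<in> L w. y \<sim> z} \<le> 1" using card_sim_le_1[OF aP wP] YL by auto
    qed
    finally have "card (L a) \<le> card Y" using card_L aP wP by simp
    then have "Y = L a" using card_seteq[OF finite_L[OF aP] YL] by simp
    moreover have "\<rho> x a \<in> L a" using \<rho>_L x a by simp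
    ultimately show ?thesis by (auto simp: Y_def)
  qed
  obtain v where v: "v \<in> V" using V_nonempty by blast
  have vP: "v \<in> V \<union> A" using v by auto
  have \<rho>v: "\<rho> x v \<in> L v" using \<rho>_L x v by simp
  obtain a where a: "a \<in> As" using As_nonempty by blast
  obtain z where z: "z \<in> L w" "z \<sim> \<rho> x a" using surj[OF a] by blast
  have zV: "z \<sim> \<rho> x u" if "u \<in> V" for u using outside_label[OF w z(1) a x z(2) that] .
  moreover have "z \<sim> \<rho> x b" if b: "b \<in> As" for b
  proof -
    obtain y where y: "y \<in> L w" "y \<sim> \<rho> x b" using surj[OF b] by blast
    have "y \<sim> \<rho> x v" using outside_label[OF w y(1) b x y(2) v] .
    then have "y = z" using sim_unique[OF vP wP \<rho>v y(1) z(1)] zV[OF v] sim_sym by blast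
    then show ?thesis using y by simp
  qed
  ultimately show ?thesis using z(1) by blast
qed

text \<open>Two nonadjacent colours could be used together and would block one colour of a instead
  of two.\<close>

lemma outside_pair:
  assumes w: "w \<in> A - As" "w' \<in> A - As" "w \<noteq> w'" and z: "z \<in> L w" "z' \<in> L w'" and a: "a \<in> As"
    and x: "x \<in> X" "z \<sim> \<rho> x a" "z' \<sim> \<rho> x a"
  shows "z \<sim> z'"
proof (rule ccontr)
  assume no: "\<not> z \<sim> z'"
  obtain v where v: "v \<in> V" using V_nonempty by blast
  obtain f :: "'v \<Rightarrow> nat" where f: "card (f ` V) \<le> k"
    "\<And>x y. \<lbrakk>x \<in> V; y \<in> V; adj x y\<rbrakk> \<Longrightarrow> f x \<noteq> f y"
    using vertex_coloring[OF v] by blast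
  have P: "w \<in> V \<union> A" "w' \<in> V \<union> A" "a \<in> V \<union> A" using w a As by auto
  have La: "\<rho> x a \<in> L a" using \<rho>_L x a by simp
  define \<phi> where "\<phi> u = (if u = w then z else z')" for u
  have col: "colors ({} \<union> {w, w'}) \<phi>"
    using z no sim_sym[of z' z] not_sim_self[OF P(1) z(1) z(1)] not_sim_self[OF P(2) z(2) z(2)] w(3)
    by (auto simp: colors_def \<phi>_def)
  have "hit ({} \<union> {w, w'}) \<phi> a \<subseteq> {\<rho> x a}"
  proof
    fix c assume "c \<in> hit ({} \<union> {w, w'}) \<phi> a"
    then have c: "c \<in> L a" "z \<sim> c \<or> z' \<sim> c" by (auto simp: hit_def \<phi>_def split: if_splits)
    then show "c \<in> {\<rho> x a}"
      using sim_unique[OF P(1,3) z(1) c(1) La] sim_unique[OF P(2,3) z(2) c(1) La] x by auto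
  qed
  then have "card (hit ({} \<union> {w, w'}) \<phi> a) \<le> 1" using card_mono[of "{\<rho> x a}"] by fastforce
  then show False
    using no_gain[OF col, of f a] w a f by auto
qed

lemma extend_labels:
  obtains \<rho>' :: "'x \<Rightarrow> 'v \<Rightarrow> 'c" where
    "\<And>x p. \<lbrakk>x \<in> X; p \<in> V \<union> A\<rbrakk> \<Longrightarrow> \<rho>' x p \<in> L p"
    "\<And>x p q. \<lbrakk>x \<in> X; p \<in> V \<union> A; q \<in> V \<union> A; adj p q\<rbrakk> \<Longrightarrow> \<rho>' x p \<sim> \<rho>' x q"
    "\<And>p. p \<in> V \<union> A \<Longrightarrow> inj_on (\<lambda>x. \<rho>' x p) X"
proof -
  define \<rho>' where "\<rho>' x p = (if p \<in> V \<union> As then \<rho> x p else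
      SOME z. z \<in> L p \<and> (\<forall>q\<in>V \<union> As. z \<sim> \<rho> x q))" for x p
  have in_: "\<rho>' x p = \<rho> x p" if "p \<in> V \<union> As" for x p using that by (simp add: \<rho>'_def)
  have out: "\<rho>' x p \<in> L p \<and> (\<forall>q\<in>V \<union> As. \<rho>' x p \<sim> \<rho> x q)" if "x \<in> X" "p \<in> A - As" for x p
  proof -
    have "\<exists>z. z \<in> L p \<and> (\<forall>q\<in>V \<union> As. z \<sim> \<rho> x q)" using outside_extension[OF that(2,1)] by blast
    moreover have "p \<notin> V \<union> As" using that V_A by auto
    ultimately show ?thesis
      unfolding \<rho>'_def using someI_ex[of "\<lambda>z. z \<in> L p \<and> (\<forall>q\<in>V \<union> As. z \<sim> \<rho> x q)"] by simp
  qed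
  have L': "\<rho>' x p \<in> L p" if "x \<in> X" "p \<in> V \<union> A" for x p
    using that in_[of p x] \<rho>_L[of x p] out[of x p] by (cases "p \<in> V \<union> As") auto
  obtain a where a: "a \<in> As" using As_nonempty by blast
  have sim': "\<rho>' x p \<sim> \<rho>' x q" if x: "x \<in> X" and pq: "p \<in> V \<union> A" "q \<in> V \<union> A" "adj p q" for x p q
  proof -
    have "p \<noteq> q" using pq adj_irrefl by auto
    consider "p \<in> V \<union> As" "q \<in> V \<union> As" | "p \<in> V \<union> As" "q \<in> A - As" | "p \<in> A - As" "q \<in> V \<union> As"
      | "p \<in> A - As" "q \<in> A - As" using pq by blast
    then show ?thesis
    proof cases
      case 1
      then show ?thesis using \<rho>_sim x pq in_ by simp
    next
      case 2
      then show ?thesis using out[OF x 2(2)] in_ sim_sym by simp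
    next
      case 3
      then show ?thesis using out[OF x 3(1)] in_ by simp
    next
      case 4
      then show ?thesis
        using outside_pair[OF 4 \<open>p \<noteq> q\<close> _ _ a x] out[OF x 4(1)] out[OF x 4(2)] a by simp
    qed
  qed
  \<comment> \<open>Injectivity at a vertex of A is inherited from V: the colour at p determines its
    neighbour at v, and there the labels are distinct.\<close>
  have inj': "inj_on (\<lambda>x. \<rho>' x p) X" if p: "p \<in> V \<union> A" for p
  proof (cases "p \<in> V")
    case True
    then show ?thesis using \<rho>_inj in_ by simp
  next
    case False
    then have pA: "p \<in> A" using p by simp
    obtain v where v: "v \<in> V" using V_nonempty by blast
    have vP: "v \<in> V \<union> A" using v by simp
    show ?thesis
    proof (rule inj_onI)
      fix x y assume xy: "x \<in> X" "y \<in> X" "\<rho>' x p = \<rho>' y p"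
      have "\<rho>' x p \<sim> \<rho>' x v" "\<rho>' x p \<sim> \<rho>' y v"
        using sim'[OF xy(1) vP p adj_VA[OF v pA]] sim'[OF xy(2) vP p adj_VA[OF v pA]] xy(3) sim_sym by auto
      then have "\<rho>' x v = \<rho>' y v"
        using sim_unique[OF p vP] L' xy p vP by blast
      then have "\<rho> x v = \<rho> y v" using in_ v by simp
      then show "x = y" using \<rho>_inj[OF v] xy by (auto dest: inj_onD)
    qed
  qed
  show ?thesis by (rule that[OF L' sim' inj'])
qed

end

section \<open>Splitting off a canonical part\<close>

text \<open>The demand \<open>k \<le> card X\<close> leaves fewer than t colours per vertex outside
  the labels, so A has room for more coloured vertices than these rests have colours.\<close>

locale split_cover = join_cover V A adj L sim k t m
  for V A :: "'v set" and adj :: "'v \<Rightarrow> 'v \<Rightarrow> bool"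
    and L :: "'v \<Rightarrow> 'c set" and sim :: "'c \<Rightarrow> 'c \<Rightarrow> bool" (infix \<open>\<sim>\<close> 50)
    and k t m :: nat +
  fixes X :: "'x set" and \<rho> :: "'x \<Rightarrow> 'v \<Rightarrow> 'c"
  assumes finite_X: "finite X" and k_le_X: "k \<le> card X"
    and \<rho>_L: "\<lbrakk>x \<in> X; p \<in> V \<union> A\<rbrakk> \<Longrightarrow> \<rho> x p \<in> L p"
    and \<rho>_sim: "\<lbrakk>x \<in> X; p \<in> V \<union> A; q \<in> V \<union> A; adj p q\<rbrakk> \<Longrightarrow> \<rho> x p \<sim> \<rho> x q"
    and \<rho>_inj: "p \<in> V \<union> A \<Longrightarrow> inj_on (\<lambda>x. \<rho> x p) X"
begin

definition R :: "'v \<Rightarrow> 'c set" where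
  "R p = L p - (\<lambda>x. \<rho> x p) ` X"

definition r :: nat where
  "r = k - 1 + t - card X"

lemma R_L: "R p \<subseteq> L p"
  by (auto simp: R_def)

lemma L_cases:
  assumes "c \<in> L p"
  obtains x where "x \<in> X" "c = \<rho> x p" | "c \<in> R p"
  using assms by (auto simp: R_def)

lemma card_X_le: "p \<in> V \<union> A \<Longrightarrow> card X \<le> k - 1 + t"
  using card_inj_on_le[OF \<rho>_inj] \<rho>_L finite_L card_L by (metis image_subsetI)

lemma card_X_eq: "card X + r = k - 1 + t"
proof -
  obtain v where "v \<in> V" using V_nonempty by blast
  then show ?thesis using card_X_le[of v] by (simp add: r_def)
qed

lemma r_less_t: "r < t"
  using card_X_eq k_le_X k_ge_2 by linarith

lemma card_R: "p \<in> V \<union> A \<Longrightarrow> card (R p) = r"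
proof -
  assume p: "p \<in> V \<union> A"
  have "(\<lambda>x. \<rho> x p) ` X \<subseteq> L p" using \<rho>_L p by auto
  then have "card (R p) = card (L p) - card ((\<lambda>x. \<rho> x p) ` X)"
    unfolding R_def using finite_X by (intro card_Diff_subset) auto
  also have "card ((\<lambda>x. \<rho> x p) ` X) = card X" using \<rho>_inj[OF p] by (rule card_image)
  finally show ?thesis using card_L[OF p] by (simp add: r_def)
qed

text \<open>The colour \<open>\<rho> x q\<close> has \<open>\<rho> x p\<close> as a neighbour
  already and can have only one in \<open>L p\<close>. Hence no edge of the cover joins a label to
  the rest.\<close>

lemma label_neighbour:
  assumes p: "p \<in> V \<union> A" "q \<in> V \<union> A" and c: "c \<in> L p" "x \<in> X" "c \<sim> \<rho> x q"
  shows "c = \<rho> x p"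
proof -
  have "adj p q" using sim_adj[OF p c(1) \<rho>_L[OF c(2) p(2)] c(3)] .
  then have "\<rho> x q \<sim> \<rho> x p" using \<rho>_sim c p sim_sym by blast
  then show ?thesis using sim_unique[OF p(2,1) _ c(1)] \<rho>_L c p sim_sym by blast
qed

lemma no_cross: "\<lbrakk>p \<in> V \<union> A; q \<in> V \<union> A; c \<in> R p; x \<in> X\<rbrakk> \<Longrightarrow> \<not> c \<sim> \<rho> x q"
  using label_neighbour R_L unfolding R_def by blast

text \<open>Colours from R on D never conflict with labels elsewhere, and labels can follow an
  ordinary proper colouring. The one used takes f on V and a separate colour for each remaining
  vertex of A; the sum type keeps the two kinds apart before they are numbered by labels.\<close>

lemma no_split:
  fixes f :: "'v \<Rightarrow> nat"
  assumes D: "D \<subseteq> V \<union> A" and col: "colors D \<phi>" and \<phi>R: "\<forall>p\<in>D. \<phi> p \<in> R p"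
    and f: "\<And>x y. \<lbrakk>x \<in> V - D; y \<in> V - D; adj x y\<rbrakk> \<Longrightarrow> f x \<noteq> f y"
    and card: "card (f ` (V - D)) + card (A - D) \<le> card X"
  shows False
proof -
  let ?S = "f ` (V - D) <+> (A - D)"
  have fin: "finite (f ` (V - D))" "finite (A - D)" using finite_V finite_A by auto
  then have "card ?S \<le> card X" using card by (simp add: card_Plus)
  then obtain e where e: "inj_on e ?S" "e ` ?S \<subseteq> X"
    using inj_on_iff_card_le[of ?S X] fin finite_X by auto
  define g where "g p = e (if p \<in> V then Inl (f p) else Inr p)" for p
  have gX: "g p \<in> X" if "p \<in> V \<union> A - D" for p
    using that e(2) by (auto simp: g_def)
  have g: "g p \<noteq> g q" if pq: "p \<in> V \<union> A - D" "q \<in> V \<union> A - D" "adj p q" for p q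
  proof
    assume eq: "g p = g q"
    have *: "(if p \<in> V then Inl (f p) else Inr p) \<in> ?S" "(if q \<in> V then Inl (f q) else Inr q) \<in> ?S"
      using pq by auto
    have "(if p \<in> V then Inl (f p) else Inr p) = (if q \<in> V then Inl (f q) else Inr q)"
      using inj_onD[OF e(1) eq[unfolded g_def] *] .
    then show False using pq f[of p q] adj_irrefl by (auto split: if_splits)
  qed
  define \<psi> where "\<psi> p = (if p \<in> D then \<phi> p else \<rho> (g p) p)" for p
  have "colors (V \<union> A) \<psi>"
    unfolding colors_def
  proof (intro conjI ballI)
    fix p assume "p \<in> V \<union> A"
    then show "\<psi> p \<in> L p" using \<phi>R R_L \<rho>_L gX by (auto simp: \<psi>_def)
  next
    fix p q assume pq: "p \<in> V \<union> A" "q \<in> V \<union> A"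
    consider "p \<in> D" "q \<in> D" | "p \<in> D" "q \<notin> D" | "p \<notin> D" "q \<in> D" | "p \<notin> D" "q \<notin> D" by blast
    then show "\<not> \<psi> p \<sim> \<psi> q"
    proof cases
      case 1
      then show ?thesis using col by (auto simp: colors_def \<psi>_def)
    next
      case 2
      then show ?thesis using no_cross[of p q "\<phi> p" "g q"] \<phi>R gX pq by (auto simp: \<psi>_def)
    next
      case 3
      then show ?thesis using no_cross[of q p "\<phi> q" "g p"] \<phi>R gX pq sim_sym by (auto simp: \<psi>_def)
    next
      case 4
      have X: "g p \<in> X" "g q \<in> X" using 4 pq gX by auto
      show ?thesis
      proof
        assume "\<psi> p \<sim> \<psi> q"
        then have s: "\<rho> (g p) p \<sim> \<rho> (g q) q" using 4 by (simp add: \<psi>_def)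
        have "\<rho> (g p) p = \<rho> (g q) p" using label_neighbour[OF pq \<rho>_L[OF X(1) pq(1)] X(2) s] .
        then have "g p = g q" using \<rho>_inj[OF pq(1)] X by (auto dest: inj_onD)
        moreover have "adj p q" using sim_adj[OF pq] \<rho>_L X pq s by blast
        ultimately show False using g[of p q] 4 pq by blast
      qed
    qed
  qed
  then show False using not_colorable by blast
qed

text \<open>A balance with \<open>card X = k - 1 + t - r\<close>. If v is in D, what remains needs
  at most \<open>k - 1\<close> labels on V and \<open>t - r\<close> on A; otherwise at most k on V
  and \<open>t - r - 1\<close> on A. Both sums equal \<open>card X\<close>. Vertex criticality is
  what lets v stand beside A.\<close>

lemma no_clique_coloring:
  assumes v: "v \<in> V"
  shows "\<nexists>D \<phi>. D \<subseteq> insert v A \<and> card D = Suc r \<and> colors D \<phi> \<and> (\<forall>p\<in>D. \<phi> p \<in> R p)"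
proof (intro notI, elim exE conjE)
  fix D \<phi> assume D: "D \<subseteq> insert v A" "card D = Suc r" "colors D \<phi>" "\<forall>p\<in>D. \<phi> p \<in> R p"
  obtain f :: "'v \<Rightarrow> nat" where f: "card (f ` (V - {v})) \<le> k - 1" "card (f ` V) \<le> k"
    "\<And>x y. \<lbrakk>x \<in> V; y \<in> V; adj x y\<rbrakk> \<Longrightarrow> f x \<noteq> f y"
    using vertex_coloring[OF v] by blast
  have vA: "v \<notin> A" using v V_A by auto
  have finD: "finite D" using D(2) card_ge_0_finite by force
  have cAD: "card (A - D) = t - card (A \<inter> D)"
    using finite_A card_A card_Diff_subset_Int[of A D] by simp
  have "card (A \<inter> D) \<le> t" using finite_A card_A card_mono[of A "A \<inter> D"] by auto
  have "card (f ` (V - D)) + card (A - D) \<le> card X"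
  proof (cases "v \<in> D")
    case True
    have "A \<inter> D = D - {v}" using D(1) vA by auto
    then have "card (A \<inter> D) = r" using True D(2) finD by simp
    moreover have "V - D = V - {v}" using D(1) True V_A by auto
    ultimately show ?thesis using f(1) cAD card_X_eq r_less_t by simp
  next
    case False
    then have "A \<inter> D = D" and "V - D = V" using D(1) v V_A by auto
    then show ?thesis using f(2) cAD D(2) card_X_eq r_less_t k_ge_2 by simp
  qed
  then show False using D f(3) v by (intro no_split[of D \<phi> f]) auto
qed

lemma clique_at:
  assumes v: "v \<in> V"
  shows "insert v A \<subseteq> V \<union> A" "\<forall>p\<in>insert v A. R p \<subseteq> L p \<and> card (R p) = r" "r < card (insert v A)"
proof -
  show "insert v A \<subseteq> V \<union> A" using v by auto
  then show "\<forall>p\<in>insert v A. R p \<subseteq> L p \<and> card (R p) = r" using card_R R_L by blast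
  have "v \<notin> A" using v V_A by auto
  then show "r < card (insert v A)" using finite_A card_A r_less_t by simp
qed

lemma R_perfect:
  assumes "v \<in> V" "p \<in> insert v A" "q \<in> insert v A" "p \<noteq> q" "c \<in> R p"
  shows "\<exists>d\<in>R q. c \<sim> d"
  by (rule clique_perfect[OF clique_at(1,2)[OF assms(1)] no_clique_coloring[OF assms(1)]
        clique_at(3)[OF assms(1)] assms(2-5)])

lemma R_triangle:
  assumes "v \<in> V" "p \<in> insert v A" "q \<in> insert v A" "s \<in> insert v A" "p \<noteq> q" "p \<noteq> s" "q \<noteq> s"
    and "c \<in> R p" "d \<in> R q" "e \<in> R s" "c \<sim> e" "d \<sim> e"
  shows "c \<sim> d"
  by (rule clique_triangle[OF clique_at(1,2)[OF assms(1)] no_clique_coloring[OF assms(1)]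
        clique_at(3)[OF assms(1)] assms(2-12)])

text \<open>Criticality puts u and v into one class W of a colouring of V that violates only the
  edge uv. If d and e were not adjacent, all of W could take the neighbours of c. By the triangles
  through A these colours act on A like a single one, so \<open>r - 1\<close> vertices of A can
  still be coloured from R, while V is relieved of a whole class.\<close>

lemma R_edge:
  assumes uv: "u \<in> V" "v \<in> V" "adj u v" and a: "a \<in> A" and c: "c \<in> R a"
    and d: "d \<in> R u" "e \<in> R v" "c \<sim> d" "c \<sim> e"
  shows "d \<sim> e"
proof (rule ccontr)
  assume no: "\<not> d \<sim> e"
  obtain f :: "'v \<Rightarrow> nat" where f: "card (f ` V) \<le> k - 1" "f u = f v"
    "\<And>y z. \<lbrakk>y \<in> V; z \<in> V; adj y z; {y, z} \<noteq> {u, v}\<rbrakk> \<Longrightarrow> f y \<noteq> f z"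
    using edge_critical[OF uv] by blast
  define W where "W = {w \<in> V. f w = f u}"
  have WV: "W \<subseteq> V" and uW: "u \<in> W" using uv by (auto simp: W_def)
  have aP: "a \<in> V \<union> A" using a by simp
  have aV: "a \<noteq> w" if "w \<in> V" for w using that a V_A by auto
  have ex: "\<exists>y. y \<in> R w \<and> c \<sim> y" if "w \<in> V" for w
    using R_perfect[OF that, of a w c] a c aV[OF that] by auto
  define \<phi> where "\<phi> w = (SOME y. y \<in> R w \<and> c \<sim> y)" for w
  have \<phi>: "\<phi> w \<in> R w \<and> c \<sim> \<phi> w" if "w \<in> V" for w
    unfolding \<phi>_def using someI_ex[OF ex[OF that]] .
  have cL: "c \<in> L a" using c R_L by blast
  have \<phi>L: "\<phi> w \<in> L w" if "w \<in> V" for w using \<phi>[OF that] R_L by blast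
  have \<phi>u: "\<phi> u = d"
    using sim_unique[OF aP _ cL \<phi>L[OF uv(1)], of d] \<phi>[OF uv(1)] d uv R_L by blast
  have \<phi>v: "\<phi> v = e"
    using sim_unique[OF aP _ cL \<phi>L[OF uv(2)], of e] \<phi>[OF uv(2)] d uv R_L by blast
  have col: "colors W \<phi>"
    unfolding colors_def
  proof (intro conjI ballI)
    fix w assume "w \<in> W"
    then show "\<phi> w \<in> L w" using \<phi>L WV by auto
  next
    fix y z assume yz: "y \<in> W" "z \<in> W"
    show "\<not> \<phi> y \<sim> \<phi> z"
    proof
      assume s: "\<phi> y \<sim> \<phi> z"
      have V: "y \<in> V" "z \<in> V" using yz WV by auto
      then have "adj y z" using sim_adj[OF _ _ \<phi>L[OF V(1)] \<phi>L[OF V(2)] s] by simp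
      then have "{y, z} = {u, v}" using f(3)[OF V] yz by (auto simp: W_def)
      then show False using s no sim_sym \<phi>u \<phi>v by (auto simp: doubleton_eq_iff)
    qed
  qed
  have r_pos: "0 < r"
    using card_R[OF aP] c finite_L[OF aP] R_L finite_subset card_gt_0_iff by (metis empty_iff)
  have "r - 1 \<le> card A" using r_less_t card_A by simp
  then obtain Z where Z: "Z \<subseteq> A" "card Z = r - 1" by (meson obtain_subset_with_card_n)
  have ZP: "Z \<subseteq> V \<union> A" and WP: "W \<subseteq> V \<union> A" using Z WV by auto
  have WZ: "W \<inter> Z = {}" using Z WV V_A by auto
  have "\<exists>\<psi>. colors (W \<union> Z) \<psi> \<and> (\<forall>w\<in>W. \<psi> w = \<phi> w) \<and> (\<forall>z\<in>Z. \<psi> z \<in> R z)"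
  proof (rule greedy_extend[OF col WP ZP WZ])
    fix z assume z: "z \<in> Z"
    then have zA: "z \<in> A" and zP: "z \<in> V \<union> A" using Z by auto
    show "R z \<subseteq> L z" by (rule R_L)
    \<comment> \<open>A colour of z in R that is blocked by W is c itself if \<open>z = a\<close>,
      and otherwise the neighbour of c; so there is at most one.\<close>
    have "y = y'" if y: "y \<in> R z \<inter> hit W \<phi> z" "y' \<in> R z \<inter> hit W \<phi> z" for y y'
    proof -
      have aux: "(z = a \<longrightarrow> y = c) \<and> (z \<noteq> a \<longrightarrow> c \<sim> y)" if y: "y \<in> R z \<inter> hit W \<phi> z" for y
      proof -
        obtain w where w: "w \<in> V" "\<phi> w \<sim> y" "y \<in> R z" "y \<in> L z" using y WV by (auto simp: hit_def)
        have wP: "w \<in> V \<union> A" using w by simp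
        have "z = a \<longrightarrow> y = c"
          using sim_unique[OF wP aP \<phi>L[OF w(1)] _ cL w(2)] w(4) \<phi>[OF w(1)] sim_sym by blast
        moreover have "c \<sim> y" if "z \<noteq> a"
          using R_triangle[OF w(1), of a z w c y "\<phi> w"] a zA w that \<phi>[OF w(1)] c
            aV[OF w(1)] V_A sim_sym by blast
        ultimately show ?thesis by blast
      qed
      show ?thesis
        using aux[OF y(1)] aux[OF y(2)] sim_unique[OF aP zP cL, of y y'] y R_L by blast
    qed
    moreover have "finite (R z \<inter> hit W \<phi> z)" using finite_hit[OF zP] by auto
    ultimately have "card (R z \<inter> hit W \<phi> z) \<le> 1" by (auto simp: card_le_Suc0_iff_eq)
    then show "card (R z \<inter> hit W \<phi> z) + card {y \<in> Z. adj y z} < card (R z)"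
      using card_others_less[OF ZP z] Z(2) card_R[OF zP] by linarith
  qed
  then obtain \<psi> where \<psi>: "colors (W \<union> Z) \<psi>" "\<forall>w\<in>W. \<psi> w = \<phi> w" "\<forall>z\<in>Z. \<psi> z \<in> R z" by blast
  have D: "V - (W \<union> Z) = V - W" "A - (W \<union> Z) = A - Z" using Z WV V_A by auto
  have "f ` (V - W) \<subseteq> f ` V - {f u}" by (auto simp: W_def)
  then have "card (f ` (V - W)) \<le> card (f ` V - {f u})" using finite_V by (intro card_mono) auto
  also have "\<dots> = card (f ` V) - 1" using uv by (intro card_Diff_singleton) auto
  finally have cf: "card (f ` (V - W)) \<le> k - 2" using f(1) by linarith
  have cZ: "card (A - Z) = t - (r - 1)"
    using Z finite_A card_A finite_subset[OF Z(1)] by (simp add: card_Diff_subset)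
  show False
  proof (rule no_split[of "W \<union> Z" \<psi> f])
    show "\<forall>p\<in>W \<union> Z. \<psi> p \<in> R p" using \<psi>(2,3) \<phi> WV by auto
    \<comment> \<open>At most \<open>k - 2\<close> classes on V and \<open>t - (r - 1)\<close>
      vertices of A remain, which is exactly \<open>card X\<close> in total.\<close>
    show "card (f ` (V - (W \<union> Z))) + card (A - (W \<union> Z)) \<le> card X"
      unfolding D using cf cZ card_X_eq r_less_t r_pos k_ge_2 by linarith
    show "f x \<noteq> f y" if "x \<in> V - (W \<union> Z)" "y \<in> V - (W \<union> Z)" "adj x y" for x y
    proof (rule f(3))
      show "{x, y} \<noteq> {u, v}" using that uW by auto
    qed (use that in auto)
  qed (use \<psi>(1) WP ZP in auto)
qed

lemma canonical_split:
  "\<exists>lam. (\<forall>v\<in>V \<union> A. bij_betw lam (L v) {1..k - 1 + t}) \<and>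
    (\<forall>u\<in>V \<union> A. \<forall>v\<in>V \<union> A. adj u v \<longrightarrow> (\<forall>c\<in>L u. \<forall>d\<in>L v. c \<sim> d \<longleftrightarrow> lam c = lam d))"
proof -
  have "A \<noteq> {}" using r_less_t card_A by auto
  then obtain a where a: "a \<in> A" by blast
  have aP: "a \<in> V \<union> A" using a by simp
  obtain v0 where v0: "v0 \<in> V" using V_nonempty by blast
  show ?thesis
  proof (rule canonical_from_neighbours[OF aP card_L])
    fix p c assume p: "p \<in> V \<union> A" "p \<noteq> a" and c: "c \<in> L a"
    have ap: "adj a p" using p a adj_A adj_VA adj_sym by blast
    from c show "\<exists>d\<in>L p. c \<sim> d"
    proof (cases rule: L_cases)
      case (1 x)
      then show ?thesis using \<rho>_L \<rho>_sim p(1) aP ap by blast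
    next
      case 2
      define v where "v = (if p \<in> V then p else v0)"
      have v: "v \<in> V" "p \<in> insert v A" using p v0 by (auto simp: v_def)
      show ?thesis using R_perfect[OF v(1), of a p c] a v p 2 R_L by blast
    qed
  next
    fix p q c d e
    assume pq: "p \<in> V \<union> A" "q \<in> V \<union> A" "p \<noteq> a" "q \<noteq> a" "adj p q"
      and cde: "c \<in> L a" "d \<in> L p" "e \<in> L q" "c \<sim> d" "c \<sim> e"
    have "p \<noteq> q" using pq adj_irrefl by auto
    from cde(1) show "d \<sim> e"
    proof (cases rule: L_cases)
      case (1 x)
      have "d = \<rho> x p" "e = \<rho> x q"
        using label_neighbour[OF pq(1) aP cde(2) 1(1)] label_neighbour[OF pq(2) aP cde(3) 1(1)]
          cde 1 sim_sym by auto
      then show ?thesis using \<rho>_sim 1 pq by simp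
    next
      case 2
      have dR: "d \<in> R p" and eR: "e \<in> R q"
        using cde no_cross[OF aP _ 2] pq by (auto simp: R_def)
      show ?thesis
      proof (cases "p \<in> V \<and> q \<in> V")
        case True
        then show ?thesis using R_edge[OF _ _ pq(5) a 2 dR eR cde(4,5)] by simp
      next
        case False
        \<comment> \<open>At most one of p and q lies in V, so A together with one vertex of V
          contains both.\<close>
        define v where "v = (if p \<in> V then p else if q \<in> V then q else v0)"
        have v: "v \<in> V" "p \<in> insert v A" "q \<in> insert v A" using pq v0 False by (auto simp: v_def)
        show ?thesis
          using R_triangle[OF v(1), of p q a d e c] v a pq dR eR 2 cde
            \<open>p \<noteq> q\<close> sim_sym by blast
      qed
    qed
  qed
qed

end

lemma (in join_cover) canonical_join:
  "\<exists>lam. (\<forall>v\<in>V \<union> A. bij_betw lam (L v) {1..k - 1 + t}) \<and>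
    (\<forall>u\<in>V \<union> A. \<forall>v\<in>V \<union> A. adj u v \<longrightarrow> (\<forall>c\<in>L u. \<forall>d\<in>L v. c \<sim> d \<longleftrightarrow> lam c = lam d))"
proof -
  obtain As X and \<rho> :: "'c \<Rightarrow> 'v \<Rightarrow> 'c" where "label_core V A adj L sim k t m As X \<rho>"
    by (rule core_exists)
  then interpret label_core V A adj L sim k t m As X \<rho> .
  obtain \<rho>' :: "'c \<Rightarrow> 'v \<Rightarrow> 'c" where \<rho>':
    "\<And>x p. \<lbrakk>x \<in> X; p \<in> V \<union> A\<rbrakk> \<Longrightarrow> \<rho>' x p \<in> L p"
    "\<And>x p q. \<lbrakk>x \<in> X; p \<in> V \<union> A; q \<in> V \<union> A; adj p q\<rbrakk> \<Longrightarrow> \<rho>' x p \<sim> \<rho>' x q"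
    "\<And>p. p \<in> V \<union> A \<Longrightarrow> inj_on (\<lambda>x. \<rho>' x p) X"
    by (rule extend_labels) blast
  interpret split_cover V A adj L sim k t m X \<rho>'
  proof
    \<comment> \<open>More than \<open>12 * m ^ 2\<close> labels are also at least k labels, as k is
      at most \<open>2 * m\<close>.\<close>
    have "m \<le> m ^ 2" using m_pos by (auto intro: self_le_power)
    then show "k \<le> card X" using k_le card_X by linarith
  qed (use \<rho>' finite_X in auto)
  show ?thesis by (rule canonical_split)
qed

section \<open>Critical graphs and joins\<close>

lemma simple_graph_edge:
  assumes "simple_graph G" "{u, v} \<in> edges G"
  shows "u \<in> verts G" "v \<in> verts G" "u \<noteq> v"
  using assms doubleton_in_nsets_2[of u v "verts G"] unfolding simple_graph_def by blast+

lemma simple_graph_edgeE: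
  assumes "simple_graph G" "e \<in> edges G"
  obtains u v where "e = {u, v}" "u \<in> verts G" "v \<in> verts G" "u \<noteq> v"
  using assms nsets2_E unfolding simple_graph_def by (metis subsetD)

lemma finite_edges: "simple_graph G \<Longrightarrow> finite (edges G)"
  unfolding simple_graph_def using finite_imp_finite_nsets finite_subset by blast

lemma proper_coloring_card:
  assumes "simple_graph G"
  shows "\<exists>f. proper_coloring G (card (verts G)) f"
proof -
  have "finite (verts G)" using assms by (simp add: simple_graph_def)
  then obtain f :: "'a \<Rightarrow> nat" where f: "bij_betw f (verts G) {1..card (verts G)}"
    by (metis card_atLeastAtMost diff_Suc_1 finite_atLeastAtMost finite_same_card_bij)
  have "proper_coloring G (card (verts G)) f"
    unfolding proper_coloring_def
  proof (intro conjI allI impI)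
    show "f \<in> verts G \<rightarrow> {1..card (verts G)}" using f by (auto simp: bij_betw_def)
    fix u v assume "{u, v} \<in> edges G"
    then show "f u \<noteq> f v"
      using simple_graph_edge[OF assms] f unfolding bij_betw_def by (metis inj_onD)
  qed
  then show ?thesis by blast
qed

lemma chromatic_number_le: "proper_coloring G k f \<Longrightarrow> chromatic_number G \<le> k"
  unfolding chromatic_number_def by (rule Least_le) blast

lemma chromatic_number_coloring:
  assumes "simple_graph G"
  shows "\<exists>f. proper_coloring G (chromatic_number G) f"
  unfolding chromatic_number_def using proper_coloring_card[OF assms] by (rule LeastI)

lemma coloring_less:
  assumes "simple_graph G" "chromatic_number G < k"
  shows "\<exists>f. proper_coloring G (k - 1) f"
proof -
  obtain f where "proper_coloring G (chromatic_number G) f"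
    using chromatic_number_coloring[OF assms(1)] by blast
  then have "proper_coloring G (k - 1) f"
    using assms(2) unfolding proper_coloring_def by fastforce
  then show ?thesis by blast
qed

lemma k_critical_vertex:
  assumes G: "k_critical k G" and v: "v \<in> verts G"
  obtains f where "f \<in> verts G - {v} \<rightarrow> {1..k - 1}"
    "\<And>x y. \<lbrakk>{x, y} \<in> edges G; x \<noteq> v; y \<noteq> v\<rbrakk> \<Longrightarrow> f x \<noteq> f y"
proof -
  define G' where "G' = \<lparr>verts = verts G - {v}, edges = {e \<in> edges G. v \<notin> e}\<rparr>"
  have s: "simple_graph G" using G by (simp add: k_critical_def)
  have s': "simple_graph G'"
    unfolding simple_graph_def
  proof
    show "finite (verts G')" using s by (simp add: G'_def simple_graph_def)
    show "edges G' \<subseteq> [verts G']\<^bsup>2\<^esup>"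
    proof
      fix e assume e: "e \<in> edges G'"
      then have "e \<in> edges G" by (simp add: G'_def)
      with s obtain x y where "e = {x, y}" "x \<in> verts G" "y \<in> verts G" "x \<noteq> y"
        by (rule simple_graph_edgeE)
      then show "e \<in> [verts G']\<^bsup>2\<^esup>" using e by (auto simp: G'_def)
    qed
  qed
  have "verts G' \<noteq> verts G" using v by (auto simp: G'_def)
  then have "G' \<noteq> G" by auto
  then have "proper_subgraph G' G" using s' by (auto simp: proper_subgraph_def G'_def)
  then obtain f where "proper_coloring G' (k - 1) f"
    using coloring_less[OF s'] G by (auto simp: k_critical_def)
  then show ?thesis by (intro that[of f]) (auto simp: proper_coloring_def G'_def)
qed

lemma k_critical_edge:
  assumes G: "k_critical k G" and k: "1 \<le> k" and uv: "{u, v} \<in> edges G"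
  obtains f where "f \<in> verts G \<rightarrow> {1..k - 1}" "f u = f v"
    "\<And>x y. \<lbrakk>{x, y} \<in> edges G; {x, y} \<noteq> {u, v}\<rbrakk> \<Longrightarrow> f x \<noteq> f y"
proof -
  define G' where "G' = \<lparr>verts = verts G, edges = edges G - {{u, v}}\<rparr>"
  have s': "simple_graph G'" using G by (auto simp: G'_def simple_graph_def k_critical_def)
  have "edges G' \<noteq> edges G" using uv by (auto simp: G'_def)
  then have "G' \<noteq> G" by auto
  then have "proper_subgraph G' G" using s' by (auto simp: proper_subgraph_def G'_def)
  then obtain f where f: "proper_coloring G' (k - 1) f"
    using coloring_less[OF s'] G by (auto simp: k_critical_def)
  then have f': "f \<in> verts G \<rightarrow> {1..k - 1}"
    "\<And>x y. \<lbrakk>{x, y} \<in> edges G; {x, y} \<noteq> {u, v}\<rbrakk> \<Longrightarrow> f x \<noteq> f y"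
    by (auto simp: proper_coloring_def G'_def)
  \<comment> \<open>Otherwise f would respect the deleted edge too and colour G with
    \<open>k - 1\<close> colours.\<close>
  moreover have "f u = f v"
  proof (rule ccontr)
    assume "f u \<noteq> f v"
    then have "f x \<noteq> f y" if "{x, y} \<in> edges G" for x y
      using f'(2)[OF that] by (cases "{x, y} = {u, v}") (auto simp: doubleton_eq_iff)
    then have "proper_coloring G (k - 1) f" using f'(1) by (simp add: proper_coloring_def)
    then have "chromatic_number G \<le> k - 1" by (rule chromatic_number_le)
    then show False using G k by (simp add: k_critical_def)
  qed
  ultimately show ?thesis by (intro that[of f])
qed

section \<open>Colourings and criticality of the join\<close>

lemma graph_join_edges:
  "{Inl u, Inl v} \<in> edges (graph_join G H) \<longleftrightarrow> {u, v} \<in> edges G"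
  "{Inr a, Inr b} \<in> edges (graph_join G H) \<longleftrightarrow> {a, b} \<in> edges H"
  "{Inl u, Inr b} \<in> edges (graph_join G H) \<longleftrightarrow> u \<in> verts G \<and> b \<in> verts H"
  "{Inr b, Inl u} \<in> edges (graph_join G H) \<longleftrightarrow> u \<in> verts G \<and> b \<in> verts H"
proof -
  let ?M = "{{Inl u, Inr v} | u v. u \<in> verts G \<and> v \<in> verts H}"
  have J: "edges (graph_join G H) = (`) Inl ` edges G \<union> (`) Inr ` edges H \<union> ?M"
    by (simp add: graph_join_def)
  have no_r: "Inl u \<in> e \<Longrightarrow> e \<notin> (`) Inr ` edges H" for u e by blast
  have no_l: "Inr a \<in> e \<Longrightarrow> e \<notin> (`) Inl ` edges G" for a e by blast
  have M: "{Inl u, Inl v} \<notin> ?M" "{Inr a, Inr b} \<notin> ?M"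
    "{Inl u, Inr b} \<in> ?M \<longleftrightarrow> u \<in> verts G \<and> b \<in> verts H" for u v a b
    by (auto simp: doubleton_eq_iff)
  have "Inl ` {u, v} \<in> (`) Inl ` edges G \<longleftrightarrow> {u, v} \<in> edges G"
    by (rule inj_image_mem_iff) (simp add: inj_image_eq_iff inj_def[of "(`) Inl"])
  then have "{Inl u, Inl v} \<in> (`) Inl ` edges G \<longleftrightarrow> {u, v} \<in> edges G"
    by (simp only: image_insert image_empty)
  then show "{Inl u, Inl v} \<in> edges (graph_join G H) \<longleftrightarrow> {u, v} \<in> edges G"
    unfolding J Un_iff using M(1)[of u v] no_r[of u "{Inl u, Inl v}"] by blast
  have "Inr ` {a, b} \<in> (`) Inr ` edges H \<longleftrightarrow> {a, b} \<in> edges H"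
    by (rule inj_image_mem_iff) (simp add: inj_image_eq_iff inj_def[of "(`) Inr"])
  then have "{Inr a, Inr b} \<in> (`) Inr ` edges H \<longleftrightarrow> {a, b} \<in> edges H"
    by (simp only: image_insert image_empty)
  then show "{Inr a, Inr b} \<in> edges (graph_join G H) \<longleftrightarrow> {a, b} \<in> edges H"
    unfolding J Un_iff using M(2)[of a b] no_l[of a "{Inr a, Inr b}"] by blast
  show "{Inl u, Inr b} \<in> edges (graph_join G H) \<longleftrightarrow> u \<in> verts G \<and> b \<in> verts H"
    unfolding J Un_iff using M(3)[of u b] no_l[of b "{Inl u, Inr b}"] no_r[of u "{Inl u, Inr b}"]
    by blast
  then show "{Inr b, Inl u} \<in> edges (graph_join G H) \<longleftrightarrow> u \<in> verts G \<and> b \<in> verts H"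
    by (simp add: insert_commute)
qed

lemma verts_graph_join: "verts (graph_join G H) = Inl ` verts G \<union> Inr ` verts H"
  by (simp add: graph_join_def Plus_def)

lemma complete_graph_simps:
  "verts (complete_graph t) = {1..t}"
  "{a, b} \<in> edges (complete_graph t) \<longleftrightarrow> a \<in> {1..t} \<and> b \<in> {1..t} \<and> a \<noteq> b"
  by (simp_all add: complete_graph_def)

lemmas join_simps = graph_join_edges verts_graph_join complete_graph_simps

text \<open>The clique uses t distinct colours, none of which occurs on G; renumbering the other
  \<open>j - t\<close> colours gives a colouring of G.\<close>

lemma join_coloring_lower:
  assumes G: "simple_graph G" and h: "proper_coloring (graph_join G (complete_graph t)) j h"
  shows "chromatic_number G + t \<le> j"
proof -
  define C where "C = (\<lambda>i. h (Inr i)) ` {1..t}"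
  have hd: "h (Inl u) \<in> {1..j}" if "u \<in> verts G" for u
    using h that by (auto simp: proper_coloring_def join_simps)
  have hC: "C \<subseteq> {1..j}" using h by (auto simp: proper_coloring_def join_simps C_def)
  have he: "h x \<noteq> h y" if "{x, y} \<in> edges (graph_join G (complete_graph t))" for x y
    using h that by (simp add: proper_coloring_def)
  have "inj_on (\<lambda>i. h (Inr i)) {1..t}"
  proof (rule inj_onI)
    fix a b assume "a \<in> {1..t}" "b \<in> {1..t}" "h (Inr a) = h (Inr b)"
    then show "a = b" using he[of "Inr a" "Inr b"] by (auto simp: join_simps)
  qed
  then have cC: "card C = t" by (simp add: C_def card_image)
  have tj: "t \<le> j" using card_mono[OF _ hC] cC by simp
  have "card ({1..j} - C) = j - t" using hC cC finite_subset[OF hC] by (simp add: card_Diff_subset)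
  then obtain e where e: "bij_betw e ({1..j} - C) {1..j - t}"
    by (metis card_atLeastAtMost diff_Suc_1 finite_Diff finite_atLeastAtMost finite_same_card_bij)
  have dom: "h (Inl u) \<in> {1..j} - C" if "u \<in> verts G" for u
  proof -
    have "h (Inl u) \<noteq> h (Inr i)" if "i \<in> {1..t}" for i
      using that \<open>u \<in> verts G\<close> by (intro he) (simp add: join_simps)
    then have "h (Inl u) \<notin> C" unfolding C_def by blast
    then show ?thesis using hd[OF that] by blast
  qed
  have "proper_coloring G (j - t) (\<lambda>u. e (h (Inl u)))"
    unfolding proper_coloring_def
  proof (intro conjI allI impI)
    show "(\<lambda>u. e (h (Inl u))) \<in> verts G \<rightarrow> {1..j - t}"
      using dom e bij_betwE by fastforce
    fix u v assume uv: "{u, v} \<in> edges G"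
    then have "h (Inl u) \<noteq> h (Inl v)" using he by (simp add: join_simps)
    then show "e (h (Inl u)) \<noteq> e (h (Inl v))"
      using dom simple_graph_edge[OF G uv] e unfolding bij_betw_def by (metis inj_onD)
  qed
  then have "chromatic_number G \<le> j - t" by (rule chromatic_number_le)
  then show ?thesis using tj by linarith
qed

text \<open>P and Q select the vertices and edges to be respected, so that deleting a vertex,
  deleting an edge and keeping the full join are instances of one statement; where nothing is
  deleted, the selector is \<open>True\<close>.\<close>

lemma join_coloringI:
  assumes p: "\<And>u. u \<in> verts G \<Longrightarrow> P (Inl u) \<Longrightarrow> f u \<in> {1..j}"
    "\<And>i. i \<in> {1..t} \<Longrightarrow> P (Inr i) \<Longrightarrow> g i \<in> {1..j}"
    and e: "\<And>u v. {u, v} \<in> edges G \<Longrightarrow> Q {Inl u, Inl v} \<Longrightarrow> f u \<noteq> f v"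
    "\<And>a b. \<lbrakk>a \<in> {1..t}; b \<in> {1..t}; a \<noteq> b; Q {Inr a, Inr b}\<rbrakk> \<Longrightarrow> g a \<noteq> g b"
    "\<And>u b. \<lbrakk>u \<in> verts G; b \<in> {1..t}; Q {Inl u, Inr b}\<rbrakk> \<Longrightarrow> f u \<noteq> g b"
  shows "\<exists>h. (\<forall>x\<in>verts (graph_join G (complete_graph t)). P x \<longrightarrow> h x \<in> {1..j}) \<and>
    (\<forall>x y. {x, y} \<in> edges (graph_join G (complete_graph t)) \<longrightarrow> Q {x, y} \<longrightarrow> h x \<noteq> h y)"
proof (intro exI[of _ "case_sum f g"] conjI ballI allI impI)
  fix x assume "x \<in> verts (graph_join G (complete_graph t))" "P x"
  then show "case_sum f g x \<in> {1..j}" using p by (cases x) (auto simp: join_simps)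
next
  fix x y assume xy: "{x, y} \<in> edges (graph_join G (complete_graph t))" "Q {x, y}"
  show "case_sum f g x \<noteq> case_sum f g y"
  proof (cases x)
    case x: (Inl u)
    show ?thesis
    proof (cases y)
      case (Inl v)
      then show ?thesis using e(1)[of u v] x xy by (simp add: join_simps)
    next
      case (Inr b)
      then show ?thesis using e(3)[of u b] x xy by (simp add: join_simps)
    qed
  next
    case x: (Inr a)
    show ?thesis
    proof (cases y)
      case (Inl v)
      then show ?thesis using e(3)[of v a] x xy by (simp add: join_simps insert_commute)
    next
      case (Inr b)
      then show ?thesis using e(2)[of a b] x xy by (simp add: join_simps)
    qed
  qed
qed

lemma join_vertex_coloring:
  assumes G: "k_critical k G" and k: "1 \<le> k" and p: "p \<in> verts (graph_join G (complete_graph t))"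
  shows "\<exists>h. (\<forall>x\<in>verts (graph_join G (complete_graph t)). x \<noteq> p \<longrightarrow> h x \<in> {1..k + t - 1}) \<and>
    (\<forall>x y. {x, y} \<in> edges (graph_join G (complete_graph t)) \<longrightarrow> p \<notin> {x, y} \<longrightarrow> h x \<noteq> h y)"
proof (cases p)
  case (Inl v)
  then have "v \<in> verts G" using p by (auto simp: join_simps)
  with G obtain f where f: "f \<in> verts G - {v} \<rightarrow> {1..k - 1}"
    "\<And>x y. \<lbrakk>{x, y} \<in> edges G; x \<noteq> v; y \<noteq> v\<rbrakk> \<Longrightarrow> f x \<noteq> f y"
    by (rule k_critical_vertex) blast
  have fr: "1 \<le> f u \<and> f u \<le> k - 1" if "u \<in> verts G" "u \<noteq> v" for u
    using f(1) that by (auto simp: Pi_iff)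
  show ?thesis
  proof (rule join_coloringI[where f = f and g = "\<lambda>i. k - 1 + i"])
    fix u assume "u \<in> verts G" "Inl u \<noteq> p"
    then show "f u \<in> {1..k + t - 1}" using fr[of u] Inl by auto
  next
    fix u b assume "u \<in> verts G" "b \<in> {1..t}" "p \<notin> {Inl u, Inr b}"
    then show "f u \<noteq> k - 1 + b" using fr[of u] Inl by auto
  qed (use f Inl k in auto)
next
  case (Inr c)
  then have c: "c \<in> {1..t}" using p by (auto simp: join_simps)
  have "simple_graph G" "chromatic_number G = k" using G by (auto simp: k_critical_def)
  then obtain f where "proper_coloring G k f" using chromatic_number_coloring by blast
  then have f: "f \<in> verts G \<rightarrow> {1..k}" "\<And>x y. {x, y} \<in> edges G \<Longrightarrow> f x \<noteq> f y"
    by (auto simp: proper_coloring_def)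
  have fr: "1 \<le> f u \<and> f u \<le> k" if "u \<in> verts G" for u using f(1) that by (auto simp: Pi_iff)
  show ?thesis
  \<comment> \<open>The clique vertices behind c move down by one and close the gap that c
    leaves.\<close>
  proof (rule join_coloringI[where f = f and g = "\<lambda>i. k + (if i < c then i else i - 1)"])
    fix u assume "u \<in> verts G"
    then show "f u \<in> {1..k + t - 1}" using fr[of u] c by auto
  next
    fix u b assume "u \<in> verts G" "b \<in> {1..t}" "p \<notin> {Inl u, Inr b}"
    then show "f u \<noteq> k + (if b < c then b else b - 1)" using fr[of u] Inr c by auto
  qed (use f Inr c in auto)
qed

text \<open>The ends of d share a colour in each of the three cases, which saves the one colour.
  Only for d inside G is edge criticality needed; for d between G and the clique, vertex criticality
  supplies the colouring.\<close>

lemma join_edge_coloring: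
  assumes G: "k_critical k G" and k: "1 \<le> k" and d: "d \<in> edges (graph_join G (complete_graph t))"
  shows "\<exists>h. (\<forall>x\<in>verts (graph_join G (complete_graph t)). True \<longrightarrow> h x \<in> {1..k + t - 1}) \<and>
    (\<forall>x y. {x, y} \<in> edges (graph_join G (complete_graph t)) \<longrightarrow> {x, y} \<noteq> d \<longrightarrow> h x \<noteq> h y)"
proof -
  have sG: "simple_graph G" using G by (simp add: k_critical_def)
  have "simple_graph (graph_join G (complete_graph t))"
    by (intro simple_graph_graph_join sG simple_graph_complete_graph)
  then obtain p q where dpq: "d = {p, q}" using d by (rule simple_graph_edgeE)
  consider u v where "d = {Inl u, Inl v}" | u b where "d = {Inl u, Inr b}"
    | a b where "d = {Inr a, Inr b}" "a < b"
  proof -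
    have "a \<noteq> b" if "d = {Inr a, Inr b}" for a b using d that by (auto simp: join_simps)
    then show ?thesis
      using that dpq by (cases p; cases q) (metis insert_commute nat_neq_iff)+
  qed
  then show ?thesis
  proof cases
    case (1 u v)
    then have "{u, v} \<in> edges G" using d by (simp add: join_simps)
    with G k obtain f where f: "f \<in> verts G \<rightarrow> {1..k - 1}" "f u = f v"
      "\<And>x y. \<lbrakk>{x, y} \<in> edges G; {x, y} \<noteq> {u, v}\<rbrakk> \<Longrightarrow> f x \<noteq> f y"
      by (rule k_critical_edge) blast
    have fr: "1 \<le> f u \<and> f u \<le> k - 1" if "u \<in> verts G" for u using f(1) that by (auto simp: Pi_iff)
    show ?thesis
    proof (rule join_coloringI[where f = f and g = "\<lambda>i. k - 1 + i"])
      fix w assume "w \<in> verts G"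
      then show "f w \<in> {1..k + t - 1}" using fr[of w] by auto
    next
      fix w b assume "w \<in> verts G" "b \<in> {1..t}"
      then show "f w \<noteq> k - 1 + b" using fr[of w] by auto
    next
      fix x y assume "{x, y} \<in> edges G" "{Inl x, Inl y} \<noteq> d"
      then show "f x \<noteq> f y" using f(3)[of x y] 1 by (auto simp: doubleton_eq_iff)
    qed (use k in auto)
  next
    case (2 v c)
    then have v: "v \<in> verts G" and c: "c \<in> {1..t}" using d by (auto simp: join_simps)
    from G v obtain f where f: "f \<in> verts G - {v} \<rightarrow> {1..k - 1}"
      "\<And>x y. \<lbrakk>{x, y} \<in> edges G; x \<noteq> v; y \<noteq> v\<rbrakk> \<Longrightarrow> f x \<noteq> f y"
      by (rule k_critical_vertex) blast
    have fr: "1 \<le> f u \<and> f u \<le> k - 1" if "u \<in> verts G" "u \<noteq> v" for u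
      using f(1) that by (auto simp: Pi_iff)
    show ?thesis
    \<comment> \<open>G without v gets by with \<open>k - 1\<close> colours, and v borrows the
      colour of its former neighbour c in the clique.\<close>
    proof (rule join_coloringI[where f = "f(v := k - 1 + c)" and g = "\<lambda>i. k - 1 + i"])
      fix w assume "w \<in> verts G"
      then show "(f(v := k - 1 + c)) w \<in> {1..k + t - 1}" using fr[of w] c k by auto
    next
      fix w b assume "w \<in> verts G" "b \<in> {1..t}" "{Inl w, Inr b} \<noteq> d"
      then show "(f(v := k - 1 + c)) w \<noteq> k - 1 + b" using fr[of w] 2 by auto
    next
      fix x y assume xy: "{x, y} \<in> edges G"
      note xy' = simple_graph_edge[OF sG xy]
      show "(f(v := k - 1 + c)) x \<noteq> (f(v := k - 1 + c)) y"
        using f(2)[OF xy] fr[of x] fr[of y] xy' c by auto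
    qed (use k in auto)
  next
    case (3 a b)
    then have ab: "a \<in> {1..t}" "b \<in> {1..t}" using d by (auto simp: join_simps)
    have "chromatic_number G = k" using G by (auto simp: k_critical_def)
    then obtain f where "proper_coloring G k f" using chromatic_number_coloring[OF sG] by blast
    then have f: "f \<in> verts G \<rightarrow> {1..k}" "\<And>x y. {x, y} \<in> edges G \<Longrightarrow> f x \<noteq> f y"
      by (auto simp: proper_coloring_def)
    have fr: "1 \<le> f u \<and> f u \<le> k" if "u \<in> verts G" for u using f(1) that by (auto simp: Pi_iff)
    \<comment> \<open>b takes over the colour of a and later vertices move down by one. Because
      \<open>a < b\<close>, the colour of a is not shifted.\<close>
    let ?g = "\<lambda>i. k + (if i < b then i else if i = b then a else i - 1)"
    show ?thesis
    proof (rule join_coloringI[where f = f and g = ?g])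
      fix w assume "w \<in> verts G"
      then show "f w \<in> {1..k + t - 1}" using fr[of w] ab by auto
    next
      fix w c assume "w \<in> verts G" "c \<in> {1..t}"
      then show "f w \<noteq> ?g c" using fr[of w] ab 3 by auto
    next
      fix x y assume "x \<in> {1..t}" "y \<in> {1..t}" "x \<noteq> y" "{Inr x, Inr y} \<noteq> d"
      then have "\<not> (x = a \<and> y = b)" "\<not> (x = b \<and> y = a)" using 3 by auto
      then show "?g x \<noteq> ?g y"
        using 3(2) \<open>x \<noteq> y\<close> by (cases "x < b"; cases "y < b"; cases "x = b"; cases "y = b") auto
    next
      fix i assume "i \<in> {1..t}"
      then show "?g i \<in> {1..k + t - 1}" using ab 3 k by auto
    qed (use f in auto)
  qed
qed

lemma k_critical_join:
  assumes G: "k_critical k G" and k: "1 \<le> k"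
  shows "k_critical (k + t) (graph_join G (complete_graph t))"
proof -
  let ?J = "graph_join G (complete_graph t)"
  have sG: "simple_graph G" and \<chi>: "chromatic_number G = k" using G by (auto simp: k_critical_def)
  have sJ: "simple_graph ?J" by (intro simple_graph_graph_join sG simple_graph_complete_graph)
  obtain f where "proper_coloring G k f" using chromatic_number_coloring[OF sG] \<chi> by blast
  then have f: "f \<in> verts G \<rightarrow> {1..k}" "\<And>x y. {x, y} \<in> edges G \<Longrightarrow> f x \<noteq> f y"
    by (auto simp: proper_coloring_def)
  have fr: "1 \<le> f u \<and> f u \<le> k" if "u \<in> verts G" for u using f(1) that by (auto simp: Pi_iff)
  have "\<exists>h. (\<forall>x\<in>verts ?J. True \<longrightarrow> h x \<in> {1..k + t}) \<and>
      (\<forall>x y. {x, y} \<in> edges ?J \<longrightarrow> True \<longrightarrow> h x \<noteq> h y)"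
  proof (rule join_coloringI[where f = f and g = "\<lambda>i. k + i"])
    fix w assume "w \<in> verts G"
    then show "f w \<in> {1..k + t}" using fr[of w] by auto
  next
    fix w b assume "w \<in> verts G" "b \<in> {1..t}"
    then show "f w \<noteq> k + b" using fr[of w] by auto
  qed (use f in auto)
  then obtain h where "\<forall>x\<in>verts ?J. h x \<in> {1..k + t}" "\<forall>x y. {x, y} \<in> edges ?J \<longrightarrow> h x \<noteq> h y"
    by blast
  then have "proper_coloring ?J (k + t) h" unfolding proper_coloring_def by blast
  then have "chromatic_number ?J \<le> k + t" by (rule chromatic_number_le)
  moreover obtain h' where "proper_coloring ?J (chromatic_number ?J) h'"
    using chromatic_number_coloring[OF sJ] by blast
  then have "k + t \<le> chromatic_number ?J" using join_coloring_lower[OF sG] \<chi> by simp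
  ultimately have \<chi>J: "chromatic_number ?J = k + t" by simp
  have "chromatic_number G' < k + t" if sub: "proper_subgraph G' ?J" for G'
  proof -
    have G': "simple_graph G'" "verts G' \<subseteq> verts ?J" "edges G' \<subseteq> edges ?J" "G' \<noteq> ?J"
      using sub by (auto simp: proper_subgraph_def)
    then have "verts G' \<noteq> verts ?J \<or> edges G' \<noteq> edges ?J" by auto
    then consider p where "p \<in> verts ?J" "p \<notin> verts G'" | d where "d \<in> edges ?J" "d \<notin> edges G'"
      using G' by blast
    then obtain h where "proper_coloring G' (k + t - 1) h"
    proof cases
      case (1 p)
      obtain h where h: "\<forall>x\<in>verts ?J. x \<noteq> p \<longrightarrow> h x \<in> {1..k + t - 1}"
        "\<forall>x y. {x, y} \<in> edges ?J \<longrightarrow> p \<notin> {x, y} \<longrightarrow> h x \<noteq> h y"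
        using join_vertex_coloring[OF G k 1(1)] by blast
      have "proper_coloring G' (k + t - 1) h"
        unfolding proper_coloring_def
      proof (intro conjI allI impI)
        show "h \<in> verts G' \<rightarrow> {1..k + t - 1}"
        proof
          fix x assume "x \<in> verts G'"
          moreover from this have "x \<noteq> p" using 1 by blast
          ultimately show "h x \<in> {1..k + t - 1}" using h(1) G' by blast
        qed
        fix u v assume uv: "{u, v} \<in> edges G'"
        then have "p \<notin> {u, v}" using simple_graph_edge[OF G'(1) uv] 1 by auto
        then show "h u \<noteq> h v" using h(2) uv G' by blast
      qed
      then show ?thesis by (rule that)
    next
      case (2 d)
      obtain h where h: "\<forall>x\<in>verts ?J. True \<longrightarrow> h x \<in> {1..k + t - 1}"
        "\<forall>x y. {x, y} \<in> edges ?J \<longrightarrow> {x, y} \<noteq> d \<longrightarrow> h x \<noteq> h y"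
        using join_edge_coloring[OF G k 2(1)] by blast
      have "proper_coloring G' (k + t - 1) h"
        unfolding proper_coloring_def
      proof (intro conjI allI impI)
        show "h \<in> verts G' \<rightarrow> {1..k + t - 1}"
        proof
          fix x assume "x \<in> verts G'"
          then show "h x \<in> {1..k + t - 1}" using h(1) G' by blast
        qed
        fix u v assume "{u, v} \<in> edges G'"
        then show "h u \<noteq> h v" using h(2) G' 2 by blast
      qed
      then show ?thesis by (rule that)
    qed
    then have "chromatic_number G' \<le> k + t - 1" by (rule chromatic_number_le)
    then show ?thesis using k by linarith
  qed
  then show ?thesis using sJ \<chi>J by (simp add: k_critical_def)
qed

section \<open>Size bounds for critical graphs\<close>

lemma degree_sum_le:
  assumes G: "simple_graph G"
  shows "(\<Sum>v\<in>verts G. card {u \<in> verts G. {u, v} \<in> edges G}) \<le> 2 * card (edges G)"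
proof -
  have fin: "finite (verts G)" using G by (simp add: simple_graph_def)
  let ?A = "SIGMA v:verts G. {u \<in> verts G. {u, v} \<in> edges G}"
  have "(\<Sum>v\<in>verts G. card {u \<in> verts G. {u, v} \<in> edges G}) = card ?A"
    using fin by (simp add: card_SigmaI)
  also have "\<dots> \<le> card (\<Union>e\<in>edges G. {(v, u). {u, v} = e})"
  proof (rule card_mono)
    have "{(v, u). {u, v} = e} \<subseteq> verts G \<times> verts G" if "e \<in> edges G" for e
      using that simple_graph_edge[OF G] by auto
    then have "(\<Union>e\<in>edges G. {(v, u). {u, v} = e}) \<subseteq> verts G \<times> verts G" by (rule UN_least)
    then show "finite (\<Union>e\<in>edges G. {(v, u). {u, v} = e})"
      by (rule finite_subset) (use fin in simp)
  qed auto
  also have "\<dots> \<le> (\<Sum>e\<in>edges G. card {(v, u). {u, v} = e})"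
    using finite_edges[OF G] by (rule card_UN_le)
  also have "\<dots> \<le> (\<Sum>e\<in>edges G. 2)"
  proof (rule sum_mono)
    fix e assume "e \<in> edges G"
    with G obtain x y where e: "e = {x, y}" by (rule simple_graph_edgeE)
    have "{(v, u). {u, v} = e} \<subseteq> {(x, y), (y, x)}"
    proof
      fix p assume "p \<in> {(v, u). {u, v} = e}"
      then have "{snd p, fst p} = {x, y}" using e by (simp add: case_prod_unfold)
      then have "snd p = x \<and> fst p = y \<or> snd p = y \<and> fst p = x" by (simp only: doubleton_eq_iff)
      then show "p \<in> {(x, y), (y, x)}" by (cases p) auto
    qed
    then have "card {(v, u). {u, v} = e} \<le> card {(x, y), (y, x)}" by (intro card_mono) auto
    also have "\<dots> \<le> 2" using card_length[of "[(x, y), (y, x)]"] by simp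
    finally show "card {(v, u). {u, v} = e} \<le> 2" .
  qed
  finally show ?thesis by simp
qed

lemma k_critical_edgeless:
  assumes G: "k_critical k G" and k: "1 \<le> k" and e: "edges G = {}"
  shows "k = 1" "card (verts G) = 1"
proof -
  have s: "simple_graph G" and \<chi>: "chromatic_number G = k" using G by (auto simp: k_critical_def)
  have "proper_coloring G 1 (\<lambda>_. 1)" using e by (simp add: proper_coloring_def)
  then show k1: "k = 1" using chromatic_number_le \<chi> k by force
  have "verts G \<noteq> {}"
  proof
    assume "verts G = {}"
    then have "proper_coloring G 0 (\<lambda>_. 0)" using e by (simp add: proper_coloring_def)
    then show False using chromatic_number_le \<chi> k by force
  qed
  then obtain v where v: "v \<in> verts G" by blast
  from G v obtain f where "f \<in> verts G - {v} \<rightarrow> {1..k - 1}" by (rule k_critical_vertex)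
  \<comment> \<open>For \<open>k = 1\<close> the range \<open>{1..k - 1}\<close> is empty, so no
    vertex besides v can exist.\<close>
  then have "verts G - {v} = {}" using k1 by (auto simp: Pi_iff)
  then have "verts G = {v}" using v by auto
  then show "card (verts G) = 1" by simp
qed

text \<open>Once there is an edge, no vertex is isolated: an isolated vertex could join any class of
  a colouring of the rest with \<open>k - 1\<close> colours. The number of vertices is thus at most
  the degree sum.\<close>

lemma k_critical_card_le:
  assumes G: "k_critical k G" and k: "1 \<le> k" and e: "edges G \<noteq> {}"
  shows "2 \<le> k" "card (verts G) \<le> 2 * card (edges G)" "k \<le> card (verts G)"
proof -
  have s: "simple_graph G" and \<chi>: "chromatic_number G = k" using G by (auto simp: k_critical_def)
  obtain d where d: "d \<in> edges G" using e by blast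
  with s obtain x y where xy: "d = {x, y}" by (rule simple_graph_edgeE)
  from G k d[unfolded xy] obtain g where "g \<in> verts G \<rightarrow> {1..k - 1}" by (rule k_critical_edge)
  moreover have "x \<in> verts G" using simple_graph_edge[OF s d[unfolded xy]] by simp
  ultimately show k2: "2 \<le> k" by (auto simp: Pi_iff dest!: bspec[of _ _ x])
  show "k \<le> card (verts G)" using proper_coloring_card[OF s] chromatic_number_le \<chi> by blast
  have fin: "finite (verts G)" using s by (simp add: simple_graph_def)
  have "1 \<le> card {u \<in> verts G. {u, v} \<in> edges G}" if v: "v \<in> verts G" for v
  proof (rule ccontr)
    assume "\<not> ?thesis"
    then have "{u \<in> verts G. {u, v} \<in> edges G} = {}" using fin by (simp add: not_le)
    then have iso: "x \<noteq> v \<and> y \<noteq> v" if "{x, y} \<in> edges G" for x y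
      using that simple_graph_edge[OF s that] by (auto simp: insert_commute)
    from G v obtain f where f: "f \<in> verts G - {v} \<rightarrow> {1..k - 1}"
      "\<And>x y. \<lbrakk>{x, y} \<in> edges G; x \<noteq> v; y \<noteq> v\<rbrakk> \<Longrightarrow> f x \<noteq> f y"
      by (rule k_critical_vertex) blast
    have "proper_coloring G (k - 1) (f(v := 1))"
      unfolding proper_coloring_def
    proof (intro conjI allI impI)
      show "f(v := 1) \<in> verts G \<rightarrow> {1..k - 1}" using f(1) k2 by (auto simp: Pi_iff)
      fix x y assume "{x, y} \<in> edges G"
      then show "(f(v := 1)) x \<noteq> (f(v := 1)) y" using iso[of x y] f(2)[of x y] by simp
    qed
    then have "k \<le> k - 1" using chromatic_number_le \<chi> by blast
    then show False using k2 by linarith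
  qed
  then have "(\<Sum>v\<in>verts G. 1) \<le> (\<Sum>v\<in>verts G. card {u \<in> verts G. {u, v} \<in> edges G})"
    by (intro sum_mono) auto
  then show "card (verts G) \<le> 2 * card (edges G)" using degree_sum_le[OF s] by simp
qed

section \<open>From covers to relations between colours\<close>

lemma list_cover_of_cover:
  assumes J: "simple_graph J" and c: "cover J L H"
  shows "list_cover (verts J) (\<lambda>x y. {x, y} \<in> edges J) L (\<lambda>x y. {x, y} \<in> edges H)"
proof -
  have H: "simple_graph H" and disj: "disjoint_family_on L (verts J)"
    and ind: "\<And>v. v \<in> verts J \<Longrightarrow> indep (L v) (edges H)"
    and un: "(\<Union>v\<in>verts J. L v) = verts H"
    and btw: "\<And>u v. \<lbrakk>u \<in> verts J; v \<in> verts J; u \<noteq> v; edges_between H (L u) (L v) \<noteq> {}\<rbrakk> \<Longrightarrow>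
        {u, v} \<in> edges J \<and> disjoint (edges_between H (L u) (L v))"
    using c unfolding cover_def by blast+
  \<comment> \<open>The matching condition of \<open>cover\<close> concerns distinct vertices only;
    independence of the lists guarantees that the ends of an edge of H belong to such
    vertices.\<close>
  have ne: "u \<noteq> v" if "u \<in> verts J" "v \<in> verts J" "c \<in> L u" "d \<in> L v" "{c, d} \<in> edges H" for u v c d
    using ind[of u] that simple_graph_edge[OF H that(5)] unfolding indep_def by blast
  have eb: "{c, d} \<in> edges_between H (L u) (L v)" if "c \<in> L u" "d \<in> L v" "{c, d} \<in> edges H" for u v c d
    using that unfolding edges_between_def by blast
  show ?thesis
  proof
    show "finite (verts J)" using J by (simp add: simple_graph_def)
    show "finite (L v)" if "v \<in> verts J" for v
      using that un H by (metis UN_upper finite_subset simple_graph_def)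
    show "u = v" if "u \<in> verts J" "v \<in> verts J" "c \<in> L u" "c \<in> L v" for u v c
      using disj that unfolding disjoint_family_on_def by blast
    show "{u, v} \<in> edges J"
      if "u \<in> verts J" "v \<in> verts J" "c \<in> L u" "d \<in> L v" "{c, d} \<in> edges H" for u v c d
      using btw[OF that(1,2) ne[OF that]] eb[OF that(3-5)] by blast
    show "d = d'" if *: "u \<in> verts J" "v \<in> verts J" "c \<in> L u" "d \<in> L v" "d' \<in> L v"
        "{c, d} \<in> edges H" "{c, d'} \<in> edges H" for u v c d d'
    proof -
      have "disjoint (edges_between H (L u) (L v))"
        using btw[OF *(1,2) ne[OF *(1,2,3,4,6)]] eb[OF *(3,4,6)] by blast
      \<comment> \<open>Matchings are encoded as disjoint families of edges, so two edges meeting in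
        c must be equal.\<close>
      moreover have "{c, d} \<inter> {c, d'} \<noteq> {}" by blast
      ultimately have "{c, d} = {c, d'}"
        using disjointD eb[OF *(3,4,6)] eb[OF *(3,5,7)] by metis
      then show ?thesis by (auto simp: doubleton_eq_iff)
    qed
    show "{v, v} \<notin> edges J" for v using simple_graph_edge[OF J, of v v] by blast
  qed (simp_all add: insert_commute)
qed

lemma bad_cover_no_colors:
  assumes J: "simple_graph J" and bad: "bad_cover J L H"
  shows "\<not> list_cover.colors L (\<lambda>x y. {x, y} \<in> edges H) (verts J) \<phi>"
proof
  have c: "cover J L H" using bad by (simp add: bad_cover_def)
  interpret list_cover "verts J" "\<lambda>x y. {x, y} \<in> edges J" L "\<lambda>x y. {x, y} \<in> edges H"
    using J c by (rule list_cover_of_cover)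
  assume col: "colors (verts J) \<phi>"
  have "cover_coloring J L H (\<phi> ` verts J)"
    unfolding cover_coloring_def
  proof (intro conjI ballI)
    show "\<phi> ` verts J \<subseteq> verts H" using col c unfolding colors_def cover_def by blast
    show "indep (\<phi> ` verts J) (edges H)" using col unfolding colors_def indep_def by blast
    fix v assume v: "v \<in> verts J"
    show "\<exists>!x. x \<in> \<phi> ` verts J \<inter> L v"
    proof (rule ex1I[of _ "\<phi> v"])
      show "\<phi> v \<in> \<phi> ` verts J \<inter> L v" using v col by (simp add: colors_def)
      fix x assume x: "x \<in> \<phi> ` verts J \<inter> L v"
      then obtain u where u: "u \<in> verts J" "x = \<phi> u" by blast
      then have "x \<in> L u" using col by (simp add: colors_def)
      then show "x = \<phi> v" using L_disjoint[OF u(1) v] x u by blast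
    qed
  qed
  then show False using bad by (auto simp: bad_cover_def)
qed

theorem theorem1p10:
  fixes G :: "'a graph" and m t :: nat
  assumes "critical G"
    and "card (edges G) = m"
    and "t \<ge> 100 * m ^ 3"
  shows "robustly_critical TYPE('c) (graph_join G (complete_graph t))"
proof -
  obtain k where k: "1 \<le> k" and G: "k_critical k G" using assms(1) by (auto simp: critical_def)
  let ?J = "graph_join G (complete_graph t)"
  let ?V = "Inl ` verts G :: ('a + nat) set" and ?A = "Inr ` {1..t} :: ('a + nat) set"
  have sG: "simple_graph G" using G by (simp add: k_critical_def)
  have sJ: "simple_graph ?J" by (intro simple_graph_graph_join sG simple_graph_complete_graph)
  have vJ: "verts ?J = ?V \<union> ?A" by (simp add: join_simps)
  have finV: "finite (verts G)" using sG by (simp add: simple_graph_def)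
  have card_A: "card ?A = t" by (simp add: card_image)
  have "canonical_cover (k + t - 1) ?J L H"
    if fold: "fold_cover (k + t - 1) ?J L H" and bad: "bad_cover ?J L H" for L and H :: "'c graph"
  proof -
    have cov: "cover ?J L H" using bad by (simp add: bad_cover_def)
    have card_L: "card (L v) = k - 1 + t" if "v \<in> verts ?J" for v
      using fold that k by (simp add: fold_cover_def)
    interpret list_cover "?V \<union> ?A" "\<lambda>x y. {x, y} \<in> edges ?J" L "\<lambda>x y. {x, y} \<in> edges H"
      using list_cover_of_cover[OF sJ cov] by (simp only: vJ)
    have nocol: "\<not> colors (?V \<union> ?A) \<phi>" for \<phi>
      using bad_cover_no_colors[OF sJ bad] unfolding vJ .
    have "\<exists>lam. (\<forall>v\<in>?V \<union> ?A. bij_betw lam (L v) {1..k - 1 + t}) \<and>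
      (\<forall>u\<in>?V \<union> ?A. \<forall>v\<in>?V \<union> ?A. {u, v} \<in> edges ?J \<longrightarrow>
        (\<forall>c\<in>L u. \<forall>d\<in>L v. {c, d} \<in> edges H \<longleftrightarrow> lam c = lam d))"
    \<comment> \<open>For \<open>m = 0\<close> the bound on t says nothing; G is then a single
      vertex and the join a clique on \<open>t + 1\<close> vertices.\<close>
    proof (cases "edges G = {}")
      case True
      note k1 = k_critical_edgeless[OF G k True]
      then obtain v where v: "verts G = {v}" by (auto simp: card_1_singleton_iff)
      show ?thesis
      proof (rule clique_canonical)
        show "{x, y} \<in> edges ?J" if "x \<in> ?V \<union> ?A" "y \<in> ?V \<union> ?A" "x \<noteq> y" for x y
          using that v by (auto simp: join_simps)
        show "card (?V \<union> ?A) = Suc (k - 1 + t)"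
          using v k1 card_A by (simp add: card_insert_if image_iff)
        show "card (L v) = k - 1 + t" if "v \<in> ?V \<union> ?A" for v using card_L[of v] that vJ by simp
        show "\<not> colors (?V \<union> ?A) \<phi>" for \<phi> by (rule nocol)
      qed
    next
      case False
      note bounds = k_critical_card_le[OF G k False]
      have adj_Inl: "{Inl x, Inl y} \<in> edges ?J \<longleftrightarrow> {x, y} \<in> edges G" for x y
        by (simp add: join_simps)
      interpret join_cover ?V ?A "\<lambda>x y. {x, y} \<in> edges ?J" L "\<lambda>x y. {x, y} \<in> edges H" k t m
      proof
        show "?V \<inter> ?A = {}" by auto
        show "?V \<noteq> {}" using bounds by auto
        show "{a, b} \<in> edges ?J" if "a \<in> ?A" "b \<in> ?A" "a \<noteq> b" for a b
          using that by (auto simp: join_simps)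
        show "{v, a} \<in> edges ?J" if "v \<in> ?V" "a \<in> ?A" for v a
          using that by (auto simp: join_simps)
        show "card ?A = t" by (rule card_A)
        show "card (L v) = k - 1 + t" if "v \<in> ?V \<union> ?A" for v using card_L[of v] that vJ by simp
        show "2 \<le> k" by (rule bounds)
        show "card ?V \<le> 2 * m" using bounds assms(2) by (simp add: card_image)
        show "k \<le> 2 * m" using bounds assms(2) by linarith
        show "100 * m ^ 3 \<le> t" by (rule assms(3))
        show "\<not> colors (?V \<union> ?A) \<phi>" for \<phi> by (rule nocol)
      next
        have "{u \<in> ?V. {u, Inl v} \<in> edges ?J} = Inl ` {u \<in> verts G. {u, v} \<in> edges G}" for v
          by (auto simp: adj_Inl)
        then have "(\<Sum>v\<in>?V. card {u \<in> ?V. {u, v} \<in> edges ?J}) =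
            (\<Sum>v\<in>verts G. card {u \<in> verts G. {u, v} \<in> edges G})"
          by (simp add: sum.reindex card_image)
        then show "(\<Sum>v\<in>?V. card {u \<in> ?V. {u, v} \<in> edges ?J}) \<le> 2 * m"
          using degree_sum_le[OF sG] assms(2) by simp
      next
        fix p assume "p \<in> ?V"
        then obtain v where v: "v \<in> verts G" "p = Inl v" by blast
        from G v(1) obtain f where f: "f \<in> verts G - {v} \<rightarrow> {1..k - 1}"
          "\<And>x y. \<lbrakk>{x, y} \<in> edges G; x \<noteq> v; y \<noteq> v\<rbrakk> \<Longrightarrow> f x \<noteq> f y"
          by (rule k_critical_vertex) blast
        \<comment> \<open>Only values on V matter; 0 is a dummy on the side of A.\<close>
        have "case_sum f (\<lambda>_. 0) ` (?V - {p}) \<subseteq> {1..k - 1}" using f(1) v by (auto simp: Pi_iff)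
        then have "card (case_sum f (\<lambda>_. 0) ` (?V - {p})) \<le> card {1..k - 1}"
          by (intro card_mono) auto
        moreover have "\<forall>x\<in>?V - {p}. \<forall>y\<in>?V - {p}. {x, y} \<in> edges ?J \<longrightarrow>
            case_sum f (\<lambda>_. 0) x \<noteq> case_sum f (\<lambda>_. 0) y"
          using f(2) v by (auto simp: adj_Inl)
        ultimately show "\<exists>f :: 'a + nat \<Rightarrow> nat. card (f ` (?V - {p})) \<le> k - 1 \<and>
            (\<forall>x\<in>?V - {p}. \<forall>y\<in>?V - {p}. {x, y} \<in> edges ?J \<longrightarrow> f x \<noteq> f y)"
          by (intro exI[of _ "case_sum f (\<lambda>_. 0)"]) simp
      next
        fix p q assume "p \<in> ?V" "q \<in> ?V" and pq: "{p, q} \<in> edges ?J"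
        then obtain u v where uv: "p = Inl u" "q = Inl v" by blast
        then have e: "{u, v} \<in> edges G" using pq by (simp add: adj_Inl)
        from G k e obtain f where f: "f \<in> verts G \<rightarrow> {1..k - 1}" "f u = f v"
          "\<And>x y. \<lbrakk>{x, y} \<in> edges G; {x, y} \<noteq> {u, v}\<rbrakk> \<Longrightarrow> f x \<noteq> f y"
          by (rule k_critical_edge) blast
        have "case_sum f (\<lambda>_. 0) ` ?V \<subseteq> {1..k - 1}" using f(1) by (auto simp: Pi_iff)
        then have "card (case_sum f (\<lambda>_. 0) ` ?V) \<le> card {1..k - 1}" by (intro card_mono) auto
        moreover have "\<forall>x\<in>?V. \<forall>y\<in>?V. {x, y} \<in> edges ?J \<longrightarrow> {x, y} \<noteq> {p, q} \<longrightarrow>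
            case_sum f (\<lambda>_. 0) x \<noteq> case_sum f (\<lambda>_. 0) y"
        proof (intro ballI impI)
          fix x y assume "x \<in> ?V" "y \<in> ?V" and xy: "{x, y} \<in> edges ?J" "{x, y} \<noteq> {p, q}"
          then obtain x' y' where x': "x = Inl x'" "y = Inl y'" by blast
          then have "{x', y'} \<in> edges G" "{x', y'} \<noteq> {u, v}"
            using xy uv by (auto simp: adj_Inl doubleton_eq_iff)
          then show "case_sum f (\<lambda>_. 0) x \<noteq> case_sum f (\<lambda>_. 0) y" using f(3) x' by simp
        qed
        ultimately show "\<exists>f :: 'a + nat \<Rightarrow> nat. card (f ` ?V) \<le> k - 1 \<and> f p = f q \<and>
            (\<forall>x\<in>?V. \<forall>y\<in>?V. {x, y} \<in> edges ?J \<longrightarrow> {x, y} \<noteq> {p, q} \<longrightarrow> f x \<noteq> f y)"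
          using f(2) uv by (intro exI[of _ "case_sum f (\<lambda>_. 0)"]) simp
      qed
      show ?thesis by (rule canonical_join)
    qed
    moreover have "k - 1 + t = k + t - 1" using k by simp
    ultimately obtain lam where lam: "\<forall>v\<in>verts ?J. bij_betw lam (L v) {1..k + t - 1}"
      "\<forall>u\<in>verts ?J. \<forall>v\<in>verts ?J. {u, v} \<in> edges ?J \<longrightarrow>
        (\<forall>c\<in>L u. \<forall>d\<in>L v. {c, d} \<in> edges H \<longleftrightarrow> lam c = lam d)"
      unfolding vJ by metis
    show ?thesis
      unfolding canonical_cover_def
    proof (intro conjI exI[of _ lam] ballI allI impI)
      show "lam \<in> verts H \<rightarrow> {1..k + t - 1}"
      proof
        fix c assume "c \<in> verts H"
        then obtain v where "v \<in> verts ?J" "c \<in> L v" using cov unfolding cover_def by blast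
        then show "lam c \<in> {1..k + t - 1}" using lam(1) bij_betwE by blast
      qed
      show "bij_betw lam (L v) {1..k + t - 1}" if "v \<in> verts ?J" for v
        using lam(1) that by blast
      show "{c, d} \<in> edges H \<longleftrightarrow> lam c = lam d"
        if "{u, v} \<in> edges ?J" "c \<in> L u" "d \<in> L v" for u v c d
        using lam(2) simple_graph_edge[OF sJ that(1)] that by blast
    qed (rule fold)
  qed
  then show ?thesis
    using k_critical_join[OF G k, of t] k
    unfolding robustly_critical_def robustly_k_critical_def by (intro exI[of _ "k + t"]) auto
qed

end
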